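(* Let $p:\mathbb{C}\to[0,\infty)$ be a $\mathcal{C}^1$ function depending only on the real part of its argument, $p(z)=p(\Re z)$, and suppose that $$\int_{\mathbb{R}}e^{-2p(x)+2yx}\,dx<\infty\qquad\text{for each }y\in\mathbb{R}.$$ Then for every $\tau>0$ the Bergman kernel of $H_\tau$ is given, for $z,w\in\mathbb{C}$, by $$K_{\tau}(z,w)=\frac{1}{2\pi}\int_{\mathbb{R}}\frac{\exp\left(\eta(z+\overline{w})\right)}{\int_{\mathbb{R}}\exp\left(2(r\eta-\tau p(r))\right)dr}\,d\eta,$$ or, in another form, $$K_{\tau}(z,w)=\frac{\tau}{2\pi}\int_{\mathbb{R}}\frac{\exp\left(\tau\eta(z+\overline{w})\right)}{\int_{\mathbb{R}}\exp\left(2\tau(r\eta-p(r))\right)dr}\,d\eta.$$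
   Context: For $\tau>0$, $H_\tau$ is the Hilbert space of entire functions $f$ on $\mathbb{C}$ with $\int_{\mathbb{C}}|f(z)|^2e^{-2\tau p(z)}\,d\lambda(z)<\infty$, where $\lambda$ is Lebesgue measure on $\mathbb{C}$. $K_\tau(z,w)$ denotes its reproducing (Bergman) kernel: $f(z)=\int_{\mathbb{C}}K_\tau(z,w)f(w)e^{-2\tau p(w)}\,d\lambda(w)$ for $f\in H_\tau$. *)

theory Defs
  imports "HOL-Analysis.Analysis"
begin

(* The library's C1_differentiable_on is restricted to functions of one real variable. *)
definition C1_function :: "('a::real_normed_vector \<Rightarrow> 'b::real_normed_vector) \<Rightarrow> bool" where
  "C1_function f \<longleftrightarrow>
     (\<exists>f' :: 'a \<Rightarrow> 'a \<Rightarrow>\<^sub>L 'b.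
        (\<forall>x. (f has_derivative blinfun_apply (f' x)) (at x)) \<and> continuous_on UNIV f')"

(* The space H_tau.  Its inner product is that of L^2(exp(-2 tau p) d lambda). *)
definition weighted_bergman_space :: "(complex \<Rightarrow> real) \<Rightarrow> real \<Rightarrow> (complex \<Rightarrow> complex) set" where
  "weighted_bergman_space p \<tau> =
     {f. f holomorphic_on UNIV \<and>
         integrable lborel (\<lambda>z. (cmod (f z))\<^sup>2 * exp (- 2 * \<tau> * p z))}"

(* The first conjunct says that w \<mapsto> cnj (K z w), the function representing evaluation
   at z, belongs to H_tau; without it the reproducing formula would not determine K. *)
definition is_bergman_kernel ::
  "(complex \<Rightarrow> real) \<Rightarrow> real \<Rightarrow> (complex \<Rightarrow> complex \<Rightarrow> complex) \<Rightarrow> bool" where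
  "is_bergman_kernel p \<tau> K \<longleftrightarrow>
     (\<forall>z. (\<lambda>w. cnj (K z w)) \<in> weighted_bergman_space p \<tau>) \<and>
     (\<forall>f \<in> weighted_bergman_space p \<tau>. \<forall>z.
        f z = (LINT w|lborel. K z w * f w * complex_of_real (exp (- 2 * \<tau> * p w))))"

definition bergman_kernel ::
  "(complex \<Rightarrow> real) \<Rightarrow> real \<Rightarrow> complex \<Rightarrow> complex \<Rightarrow> complex" where
  "bergman_kernel p \<tau> = (THE K. is_bergman_kernel p \<tau> K)"

end

theory Submission
  imports Defs "HOL-Probability.Probability" "HOL-Complex_Analysis.Complex_Analysis"
begin

text \<open>Write \<open>\<phi> = \<tau> p\<close> on the real line and \<open>G \<eta> = \<integral> exp (2 (r \<eta> - \<phi> r)) dr\<close>; the claimed kernel is \<open>k (z + cnj w)\<close>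
with \<open>k s = (1 / 2\<pi>) \<integral> exp (\<eta> s) / G \<eta> d\<eta>\<close>. The entire function \<open>k\<close> restricted to a vertical line is a Fourier
transform, so Plancherel's inequality and Tonelli's theorem give \<open>k (z + cnj w) \<in> L\<^sup>2(exp (-2\<phi>))\<close> as a function of \<open>w\<close>.

For the reproducing property let \<open>A_u \<eta>\<close> be the integral of \<open>exp (- \<eta> w) f w\<close> over the segment
\<open>Re w = u\<close>, \<open>|Im w| \<le> T\<close>. Up to a factor \<open>1 / 2\<pi>\<close>, the integral of \<open>k (z + cnj w) f w exp (-2\<phi>)\<close> over the box \<open>[-N, N] \<times> [-T, T]\<close> equals
the \<open>\<eta>\<close>-integral of \<open>exp (\<eta> z) / G \<eta>\<close> times \<open>\<integral> exp (2 (u \<eta> - \<phi> u)) A_u \<eta> du\<close>, \<open>|u| \<le> N\<close>.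
By Cauchy's theorem \<open>A_u\<close> may be replaced by \<open>A_b\<close> for \<open>\<eta> > 0\<close> and by \<open>A_a\<close> for \<open>\<eta> < 0\<close>, where
\<open>a < Re z < b\<close>; the error is controlled by the \<open>L\<^sup>1\<close> norms of \<open>f\<close> on the horizontal edges, which tend to \<open>0\<close> along
suitable \<open>T \<rightarrow> \<infinity>\<close> because \<open>f\<close> is square integrable on vertical strips. What remains is the integral of
\<open>exp (\<eta> z) A_c \<eta> G_N \<eta> / G \<eta>\<close> with \<open>G_N\<close> the truncation of \<open>G\<close> to \<open>[-N, N]\<close> and \<open>c\<close> one of \<open>a\<close>, \<open>b\<close>.
Without the factor \<open>G_N / G\<close> this is Cauchy's integral formula for the strip. Since
\<open>a\<close> and \<open>b\<close> can be chosen with \<open>f\<close> in \<open>L\<^sup>2\<close> on both lines, Plancherel's inequality and the Cauchy-Schwarz inequality make the effect of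
this factor small as \<open>N \<rightarrow> \<infinity>\<close>, uniformly in \<open>T\<close>.\<close>

section \<open>Lebesgue measure on the complex plane and Gaussian integrals\<close>

lemma measurable_Complex [measurable (raw)]:
  assumes "f \<in> borel_measurable M" "g \<in> borel_measurable M"
  shows "(\<lambda>x. Complex (f x) (g x)) \<in> borel_measurable M"
  using assms unfolding Complex_eq by measurable

text \<open>Lebesgue measure is determined by its values on boxes, and the preimage of a box under
  \<open>Complex\<close> is a product of two intervals. The iterated forms of area integrals below
  rest on this identity.\<close>

lemma lborel_complex:
  "(lborel :: complex measure) =
     distr (lborel \<Otimes>\<^sub>M lborel) borel (\<lambda>x. Complex (fst x) (snd x))"
proof (rule lborel_eqI)
  fix l u :: complex
  assume le: "\<And>b. b \<in> Basis \<Longrightarrow> l \<bullet> b \<le> u \<bullet> b"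
  have le': "Re l \<le> Re u" "Im l \<le> Im u"
    using le[of 1] le[of \<i>] by (auto simp: Basis_complex_def)
  have eq: "(\<lambda>x. Complex (fst x) (snd x)) -` box l u =
      {Re l<..<Re u} \<times> {Im l<..<Im u}"
    by (auto simp: box_def Basis_complex_def)
  have "emeasure (distr (lborel \<Otimes>\<^sub>M lborel) borel (\<lambda>x. Complex (fst x) (snd x))) (box l u)
      = emeasure (lborel \<Otimes>\<^sub>M lborel) ({Re l<..<Re u} \<times> {Im l<..<Im u})"
    by (subst emeasure_distr) (auto simp: eq space_pair_measure)
  also have "\<dots> = ennreal ((Re u - Re l) * (Im u - Im l))"
    using le' by (subst lborel.emeasure_pair_measure_Times) (auto simp: ennreal_mult)
  finally show "emeasure (distr (lborel \<Otimes>\<^sub>M lborel) borel (\<lambda>x. Complex (fst x) (snd x))) (box l u)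
      = ennreal (\<Prod>b\<in>Basis. (u - l) \<bullet> b)"
    by (simp add: Basis_complex_def algebra_simps)
qed simp

lemma nn_integral_complex:
  assumes [measurable]: "f \<in> borel_measurable borel"
  shows "(\<integral>\<^sup>+w. f w \<partial>lborel) = (\<integral>\<^sup>+u. \<integral>\<^sup>+v. f (Complex u v) \<partial>lborel \<partial>lborel)"
proof -
  have "(\<integral>\<^sup>+w. f w \<partial>lborel) = (\<integral>\<^sup>+x. f (Complex (fst x) (snd x)) \<partial>(lborel \<Otimes>\<^sub>M lborel))"
    by (subst lborel_complex, subst nn_integral_distr) auto
  also have "\<dots> = (\<integral>\<^sup>+u. \<integral>\<^sup>+v. f (Complex u v) \<partial>lborel \<partial>lborel)"
    by (subst lborel.nn_integral_fst[symmetric]) auto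
  finally show ?thesis .
qed

lemma nn_integral_complex_swapped:
  assumes [measurable]: "f \<in> borel_measurable borel"
  shows "(\<integral>\<^sup>+w. f w \<partial>lborel) = (\<integral>\<^sup>+v. \<integral>\<^sup>+u. f (Complex u v) \<partial>lborel \<partial>lborel)"
  by (subst nn_integral_complex, simp, subst lborel_pair.Fubini'[symmetric]) auto

lemma integral_complex:
  fixes f :: "complex \<Rightarrow> 'a::{banach, second_countable_topology}"
  assumes "integrable lborel f"
  shows "(LINT w|lborel. f w) = (LINT u|lborel. LINT v|lborel. f (Complex u v))"
proof -
  have [measurable]: "f \<in> borel_measurable borel" using assms by auto
  have int: "integrable (lborel \<Otimes>\<^sub>M lborel) (\<lambda>x. f (Complex (fst x) (snd x)))"
    using assms by (subst (asm) lborel_complex, subst (asm) integrable_distr_eq) auto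
  have "(LINT w|lborel. f w) = (LINT x|(lborel \<Otimes>\<^sub>M lborel). f (Complex (fst x) (snd x)))"
    by (subst lborel_complex, subst integral_distr) auto
  also have "\<dots> = (LINT u|lborel. LINT v|lborel. f (Complex u v))"
    by (subst lborel_pair.integral_fst'[OF int, symmetric]) auto
  finally show ?thesis .
qed

lemma indicator_cbox_Complex:
  "indicator (cbox (Complex (-N) (-T)) (Complex N T)) (Complex u v) = (indicator {-N..N} u * indicator {-T..T} v :: real)"
  by (auto simp: indicator_def in_cbox_complex_iff)

lemma integrable_continuous_on_Icc:
  fixes f :: "real \<Rightarrow> 'a::{banach, second_countable_topology}"
  assumes "continuous_on {a..b} f"
  shows "integrable lborel (\<lambda>x. indicator {a..b} x *\<^sub>R f x)"
  using borel_integrable_atLeastAtMost'[OF assms] by (simp add: set_integrable_def)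

text \<open>Cauchy-Schwarz. A non-integrable product has Bochner integral 0 by convention, so in
  that case a nonnegative right side is enough.\<close>

lemma norm_integral_mult_le_L2:
  fixes f g :: "real \<Rightarrow> complex"
  assumes [measurable]: "f \<in> borel_measurable lborel" "g \<in> borel_measurable lborel"
    and f2: "(\<integral>\<^sup>+x. ennreal ((cmod (f x))\<^sup>2) \<partial>lborel) \<le> ennreal A"
    and g2: "(\<integral>\<^sup>+x. ennreal ((cmod (g x))\<^sup>2) \<partial>lborel) \<le> ennreal B"
    and nonneg: "0 \<le> A" "0 \<le> B"
  shows "cmod (LINT x|lborel. f x * g x) \<le> sqrt (A * B)"
proof (cases "integrable lborel (\<lambda>x. f x * g x)")
  case True
  have "ennreal ((cmod (LINT x|lborel. f x * g x))\<^sup>2) = (ennreal (cmod (LINT x|lborel. f x * g x)))\<^sup>2"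
    by (simp add: ennreal_power)
  also have "\<dots> \<le> (\<integral>\<^sup>+x. ennreal (cmod (f x * g x)) \<partial>lborel)\<^sup>2"
    by (intro power_mono integral_norm_bound_ennreal True) auto
  also have "\<dots> = (\<integral>\<^sup>+x. ennreal (cmod (f x)) * ennreal (cmod (g x)) \<partial>lborel)\<^sup>2"
    by (simp add: norm_mult ennreal_mult)
  also have "\<dots> \<le> (\<integral>\<^sup>+x. (ennreal (cmod (f x)))\<^sup>2 \<partial>lborel) * (\<integral>\<^sup>+x. (ennreal (cmod (g x)))\<^sup>2 \<partial>lborel)"
    by (rule Cauchy_Schwarz_nn_integral) auto
  also have "\<dots> \<le> ennreal A * ennreal B"
    using f2 g2 by (intro mult_mono) (auto simp: ennreal_power)
  finally have "(cmod (LINT x|lborel. f x * g x))\<^sup>2 \<le> A * B"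
    using nonneg by (simp add: ennreal_mult[symmetric] ennreal_le_iff)
  then show ?thesis using real_le_rsqrt by blast
next
  case False
  then show ?thesis using nonneg by (simp add: not_integrable_integral_eq)
qed

text \<open>The value is read off from the characteristic function of the standard normal law and
  rescaled by \<open>v = c * x\<close>.\<close>

lemma gaussian_fourier:
  fixes s c :: real
  assumes "0 < c"
  shows "integrable lborel (\<lambda>v. exp (- (v / c)\<^sup>2 / 2))"
    and "(LINT v|lborel. complex_of_real (exp (- (v / c)\<^sup>2 / 2)) * iexp (- (s * v))) =
           complex_of_real (c * sqrt (2 * pi) * exp (- (c * s)\<^sup>2 / 2))"
proof -
  have std: "std_normal_density = (\<lambda>x. exp (- x\<^sup>2 / 2) / sqrt (2 * pi))"
    by (simp add: std_normal_density_def fun_eq_iff)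
  have "integrable lborel (\<lambda>x. sqrt (2 * pi) * std_normal_density x)"
    using integrable_normal_density[of 1 0] by simp
  then have int: "integrable lborel (\<lambda>x. exp (- x\<^sup>2 / 2) :: real)"
    by (simp add: std)
  show "integrable lborel (\<lambda>v. exp (- (v / c)\<^sup>2 / 2))"
    using lborel_integrable_real_affine[OF int, of "1/c" 0] assms by simp
  have "complex_of_real (exp (- (c * s)\<^sup>2 / 2)) = char std_normal_distribution (- (c * s))"
    by (simp add: char_std_normal_distribution)
  also have "\<dots> = (LINT x|lborel. std_normal_density x *\<^sub>R iexp (- (c * s) * x))"
    unfolding char_def by (subst integral_density) (auto simp: normal_density_nonneg)
  also have "\<dots> = (LINT x|lborel. complex_of_real (exp (- x\<^sup>2 / 2)) * iexp (- (s * (c * x))) / complex_of_real (sqrt (2 * pi)))"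
    by (intro Bochner_Integration.integral_cong) (auto simp: std scaleR_conv_of_real mult_ac)
  also have "\<dots> = (LINT x|lborel. complex_of_real (exp (- x\<^sup>2 / 2)) * iexp (- (s * (c * x)))) / complex_of_real (sqrt (2 * pi))"
    by simp
  finally have *: "(LINT x|lborel. complex_of_real (exp (- x\<^sup>2 / 2)) * iexp (- (s * (c * x)))) =
     complex_of_real (sqrt (2 * pi) * exp (- (c * s)\<^sup>2 / 2))"
    by (simp add: field_simps)
  have "(LINT v|lborel. complex_of_real (exp (- (v / c)\<^sup>2 / 2)) * iexp (- (s * v))) =
     c *\<^sub>R (LINT x|lborel. complex_of_real (exp (- x\<^sup>2 / 2)) * iexp (- (s * (c * x))))"
    using assms by (subst lborel_integral_real_affine[of c _ 0]) auto
  also have "\<dots> = complex_of_real (c * sqrt (2 * pi) * exp (- (c * s)\<^sup>2 / 2))"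
    by (subst *) (simp add: scaleR_conv_of_real)
  finally show "(LINT v|lborel. complex_of_real (exp (- (v / c)\<^sup>2 / 2)) * iexp (- (s * v))) =
           complex_of_real (c * sqrt (2 * pi) * exp (- (c * s)\<^sup>2 / 2))" .
qed

text \<open>The integrand is \<open>2 * pi\<close> times the normal density with mean
  \<open>t\<close> and standard deviation \<open>1 / c\<close>; hence its mass does not depend on
  \<open>c\<close>.\<close>

lemma gaussian_nn_integral:
  fixes t c :: real
  assumes "0 < c"
  shows "(\<integral>\<^sup>+s. ennreal (c * sqrt (2 * pi) * exp (- (c * (s - t))\<^sup>2 / 2)) \<partial>lborel) = ennreal (2 * pi)"
proof -
  have "c * sqrt (2 * pi) * exp (- (c * (s - t))\<^sup>2 / 2) = 2 * pi * normal_density t (1 / c) s" for s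
  proof -
    define r where "r = sqrt (2 * pi)"
    have r: "2 * pi = r * r" "0 < r" by (simp_all add: r_def)
    have "sqrt (2 * pi * (1 / c)\<^sup>2) = r / c"
      using assms by (simp add: r_def power_divide real_sqrt_divide)
    moreover have "- (s - t)\<^sup>2 / (2 * (1 / c)\<^sup>2) = - (c * (s - t))\<^sup>2 / 2"
      by (simp add: power_divide power_mult_distrib)
    ultimately have "normal_density t (1 / c) s = c / r * exp (- (c * (s - t))\<^sup>2 / 2)"
      unfolding normal_density_def by simp
    then show ?thesis
      unfolding r_def[symmetric] r(1) using r(2) by simp
  qed
  then have "(\<integral>\<^sup>+s. ennreal (c * sqrt (2 * pi) * exp (- (c * (s - t))\<^sup>2 / 2)) \<partial>lborel) =
      (\<integral>\<^sup>+s. ennreal (2 * pi) * ennreal (normal_density t (1 / c) s) \<partial>lborel)"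
    by (simp add: ennreal_mult)
  also have "\<dots> = ennreal (2 * pi) * ennreal (LINT s|lborel. normal_density t (1 / c) s)"
    using assms by (subst nn_integral_cmult, simp, subst nn_integral_eq_integral) auto
  also have "\<dots> = ennreal (2 * pi)" using assms by simp
  finally show ?thesis .
qed

section \<open>Plancherel's inequality\<close>

lemma borel_measurable_cnj [measurable (raw)]:
  "f \<in> borel_measurable M \<Longrightarrow> (\<lambda>x. cnj (f x)) \<in> borel_measurable M"
  by (rule measurable_compose[OF _ borel_measurable_continuous_onI]) (auto intro!: continuous_on_cnj continuous_on_id)

text \<open>Domination by a product of integrable functions of separate variables; this justifies
  the later exchanges of Bochner integrals.\<close>

lemma integrable_pair_bound:
  fixes F :: "'a::euclidean_space \<times> 'b::euclidean_space \<Rightarrow> 'c::{banach, second_countable_topology}"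
  assumes [measurable]: "F \<in> borel_measurable (lborel \<Otimes>\<^sub>M lborel)"
    and a: "integrable lborel a" and b: "integrable lborel b"
    and bound: "\<And>x y. norm (F (x, y)) \<le> a x * b y"
  shows "integrable (lborel \<Otimes>\<^sub>M lborel) F"
proof -
  have [measurable]: "a \<in> borel_measurable borel" "b \<in> borel_measurable borel"
    using a b by auto
  have "integrable (lborel \<Otimes>\<^sub>M lborel) (\<lambda>p. a (fst p) * b (snd p))"
  proof (rule lborel_pair.Fubini_integrable)
    have "integrable lborel (\<lambda>x. norm (a x) * (LINT y|lborel. norm (b y)))"
      using a by simp
    then show "integrable lborel (\<lambda>x. LINT y|lborel. norm (a (fst (x, y)) * b (snd (x, y))))"
      by (simp add: abs_mult)
  qed (use b in auto)
  then show ?thesis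
    by (rule Bochner_Integration.integrable_bound)
       (use bound in \<open>auto intro!: AE_I2 order_trans[OF bound]\<close>)
qed

lemma norm_fourier_le:
  fixes g :: "real \<Rightarrow> complex"
  shows "cmod (LINT s|lborel. g s * iexp (- (s * v))) \<le> (LINT s|lborel. cmod (g s))"
proof -
  have "cmod (LINT s|lborel. g s * iexp (- (s * v))) \<le> (LINT s|lborel. cmod (g s * iexp (- (s * v))))"
    by (rule integral_norm_bound)
  then show ?thesis by (simp add: norm_mult)
qed

text \<open>Once the integrals are exchanged, the inner one over \<open>v\<close> is the Gaussian
  transform at frequency \<open>s - t\<close>.\<close>

lemma integral_fourier_gaussian:
  fixes g :: "real \<Rightarrow> complex"
  assumes g: "integrable lborel g" and c: "0 < c"
  shows "(LINT v|lborel. complex_of_real (exp (- (v / c)\<^sup>2 / 2)) * iexp (- (s * v)) * cnj (LINT t|lborel. g t * iexp (- (t * v))))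
    = (LINT t|lborel. cnj (g t) * complex_of_real (c * sqrt (2 * pi) * exp (- (c * (s - t))\<^sup>2 / 2)))"
proof -
  have [measurable]: "g \<in> borel_measurable borel" using g by auto
  have "(LINT v|lborel. complex_of_real (exp (- (v / c)\<^sup>2 / 2)) * iexp (- (s * v)) * cnj (LINT t|lborel. g t * iexp (- (t * v))))
     = (LINT v|lborel. LINT t|lborel. cnj (g t) * (complex_of_real (exp (- (v / c)\<^sup>2 / 2)) * iexp (- ((s - t) * v))))"
  proof (intro Bochner_Integration.integral_cong refl)
    fix v :: real
    have "complex_of_real (exp (- (v / c)\<^sup>2 / 2)) * iexp (- (s * v)) * cnj (LINT t|lborel. g t * iexp (- (t * v)))
       = complex_of_real (exp (- (v / c)\<^sup>2 / 2)) * iexp (- (s * v)) * (LINT t|lborel. cnj (g t * iexp (- (t * v))))"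
      by (simp only: Bochner_Integration.integral_cnj)
    also have "\<dots> = (LINT t|lborel. complex_of_real (exp (- (v / c)\<^sup>2 / 2)) * iexp (- (s * v)) * cnj (g t * iexp (- (t * v))))"
      by (rule integral_mult_right_zero[symmetric])
    also have "\<dots> = (LINT t|lborel. cnj (g t) * (complex_of_real (exp (- (v / c)\<^sup>2 / 2)) * iexp (- ((s - t) * v))))"
    proof (intro Bochner_Integration.integral_cong refl)
      fix t
      have "iexp (- (s * v)) * cnj (iexp (- (t * v))) = iexp (- ((s - t) * v))"
        by (simp add: exp_cnj exp_add[symmetric] algebra_simps)
      show "complex_of_real (exp (- (v / c)\<^sup>2 / 2)) * iexp (- (s * v)) * cnj (g t * iexp (- (t * v)))
        = cnj (g t) * (complex_of_real (exp (- (v / c)\<^sup>2 / 2)) * iexp (- ((s - t) * v)))"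
        unfolding \<open>iexp (- (s * v)) * cnj (iexp (- (t * v))) = iexp (- ((s - t) * v))\<close>[symmetric] complex_cnj_mult
        by (simp only: mult_ac)
    qed
    finally show "complex_of_real (exp (- (v / c)\<^sup>2 / 2)) * iexp (- (s * v)) * cnj (LINT t|lborel. g t * iexp (- (t * v)))
       = (LINT t|lborel. cnj (g t) * (complex_of_real (exp (- (v / c)\<^sup>2 / 2)) * iexp (- ((s - t) * v))))" .
  qed
  also have "\<dots> = (LINT t|lborel. LINT v|lborel. cnj (g t) * (complex_of_real (exp (- (v / c)\<^sup>2 / 2)) * iexp (- ((s - t) * v))))"
  proof (rule lborel_pair.Fubini_integral, rule integrable_pair_bound)
    show "integrable lborel (\<lambda>t. cmod (g t))" using g by simp
    show "integrable lborel (\<lambda>v. exp (- (v / c)\<^sup>2 / 2))" by (rule gaussian_fourier(1)[OF c])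
  qed (auto simp: norm_mult)
  also have "\<dots> = (LINT t|lborel. cnj (g t) * complex_of_real (c * sqrt (2 * pi) * exp (- (c * (s - t))\<^sup>2 / 2)))"
    by (simp only: integral_mult_right_zero gaussian_fourier(2)[OF c])
  finally show ?thesis .
qed

text \<open>A Schur test: the kernel is symmetric with all row and column integrals equal to
  \<open>2 * pi\<close>, and \<open>x * y <= x^2 / 2 + y^2 / 2\<close> splits the form into two
  equal halves.\<close>

lemma nn_integral_gaussian_form_le:
  fixes g :: "real \<Rightarrow> complex"
  assumes [measurable]: "g \<in> borel_measurable borel" and c: "0 < c"
  shows "(\<integral>\<^sup>+s. \<integral>\<^sup>+t. ennreal (cmod (g s) * cmod (g t) * (c * sqrt (2 * pi) * exp (- (c * (s - t))\<^sup>2 / 2))) \<partial>lborel \<partial>lborel)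
     \<le> ennreal (2 * pi) * (\<integral>\<^sup>+s. ennreal ((cmod (g s))\<^sup>2) \<partial>lborel)"
proof -
  define K where "K s t = c * sqrt (2 * pi) * exp (- (c * (s - t))\<^sup>2 / 2)" for s t :: real
  have [measurable]: "case_prod K \<in> borel_measurable (borel \<Otimes>\<^sub>M borel)"
    unfolding K_def by measurable
  have K0: "0 \<le> K s t" for s t using c by (simp add: K_def)
  have Ks: "(\<integral>\<^sup>+s. ennreal (K s t) \<partial>lborel) = ennreal (2 * pi)" for t
    unfolding K_def by (rule gaussian_nn_integral[OF c])
  have "K s t = K t s" for s t by (simp add: K_def power_mult_distrib power2_commute)
  then have Kt: "(\<integral>\<^sup>+t. ennreal (K s t) \<partial>lborel) = ennreal (2 * pi)" for s
    using Ks[of s] by simp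
  define I where "I = (\<integral>\<^sup>+s. ennreal ((cmod (g s))\<^sup>2) \<partial>lborel)"
  have amgm: "cmod (g s) * cmod (g t) * K s t \<le> (cmod (g s))\<^sup>2 / 2 * K s t + (cmod (g t))\<^sup>2 / 2 * K s t" for s t
  proof -
    have "cmod (g s) * cmod (g t) \<le> (cmod (g s))\<^sup>2 / 2 + (cmod (g t))\<^sup>2 / 2"
      using sum_squares_bound[of "cmod (g s)" "cmod (g t)"] by simp
    from mult_right_mono[OF this K0[of s t]] show ?thesis by (simp add: algebra_simps)
  qed
  have half: "(\<integral>\<^sup>+s. ennreal ((cmod (g s))\<^sup>2 / 2) \<partial>lborel) = I / 2"
  proof -
    have "ennreal ((cmod (g s))\<^sup>2 / 2) = ennreal ((cmod (g s))\<^sup>2) / 2" for s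
      using divide_ennreal[of "(cmod (g s))\<^sup>2" 2] by simp
    then show ?thesis unfolding I_def by (simp add: nn_integral_divide)
  qed
  have "(\<integral>\<^sup>+s. \<integral>\<^sup>+t. ennreal (cmod (g s) * cmod (g t) * K s t) \<partial>lborel \<partial>lborel)
     \<le> (\<integral>\<^sup>+s. \<integral>\<^sup>+t. ennreal ((cmod (g s))\<^sup>2 / 2) * ennreal (K s t) + ennreal ((cmod (g t))\<^sup>2 / 2) * ennreal (K s t) \<partial>lborel \<partial>lborel)"
    using K0 by (intro nn_integral_mono)
       (auto simp flip: ennreal_mult' ennreal_plus intro!: ennreal_leI order_trans[OF amgm])
  also have "\<dots> = (\<integral>\<^sup>+s. ennreal ((cmod (g s))\<^sup>2 / 2) * ennreal (2 * pi) + (\<integral>\<^sup>+t. ennreal ((cmod (g t))\<^sup>2 / 2) * ennreal (K s t) \<partial>lborel) \<partial>lborel)"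
    by (simp add: nn_integral_add nn_integral_cmult Kt)
  also have "\<dots> = (\<integral>\<^sup>+s. ennreal ((cmod (g s))\<^sup>2 / 2) * ennreal (2 * pi) \<partial>lborel) +
      (\<integral>\<^sup>+s. \<integral>\<^sup>+t. ennreal ((cmod (g t))\<^sup>2 / 2) * ennreal (K s t) \<partial>lborel \<partial>lborel)"
    by (rule nn_integral_add) auto
  also have "(\<integral>\<^sup>+s. \<integral>\<^sup>+t. ennreal ((cmod (g t))\<^sup>2 / 2) * ennreal (K s t) \<partial>lborel \<partial>lborel)
      = (\<integral>\<^sup>+t. \<integral>\<^sup>+s. ennreal ((cmod (g t))\<^sup>2 / 2) * ennreal (K s t) \<partial>lborel \<partial>lborel)"
    by (rule lborel_pair.Fubini'[symmetric]) measurable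
  also have "\<dots> = (\<integral>\<^sup>+t. ennreal ((cmod (g t))\<^sup>2 / 2) * ennreal (2 * pi) \<partial>lborel)"
    by (simp add: nn_integral_cmult Ks)
  also have "(\<integral>\<^sup>+s. ennreal ((cmod (g s))\<^sup>2 / 2) * ennreal (2 * pi) \<partial>lborel) = I / 2 * ennreal (2 * pi)"
    by (subst nn_integral_multc) (auto simp: half)
  also have "I / 2 * ennreal (2 * pi) + I / 2 * ennreal (2 * pi) = ennreal (2 * pi) * I"
  proof -
    have "I / 2 + I / 2 = I"
      by (subst mult_2_right[symmetric], subst ennreal_divide_times) simp
    then show ?thesis by (simp add: distrib_right[symmetric] mult.commute)
  qed
  finally show ?thesis unfolding K_def I_def .
qed

lemma norm_integral_le_nn_integral:
  fixes f :: "'a \<Rightarrow> 'b::{banach, second_countable_topology}"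
  shows "ennreal (norm (integral\<^sup>L M f)) \<le> (\<integral>\<^sup>+x. ennreal (norm (f x)) \<partial>M)"
  by (cases "integrable M f") (auto simp: integral_norm_bound_ennreal not_integrable_integral_eq)

text \<open>The Gaussian weight makes the triple integral absolutely convergent; its Fourier transform is an
  approximate identity of mass \<open>2\<pi>\<close>, which yields a bound independent of \<open>c\<close>.\<close>

lemma fourier_L2_gaussian_bound:
  fixes g :: "real \<Rightarrow> complex"
  assumes g: "integrable lborel g" and c: "0 < c"
  shows "(\<integral>\<^sup>+v. ennreal (exp (- (v / c)\<^sup>2 / 2) * (cmod (LINT s|lborel. g s * iexp (- (s * v))))\<^sup>2) \<partial>lborel)
     \<le> ennreal (2 * pi) * (\<integral>\<^sup>+s. ennreal ((cmod (g s))\<^sup>2) \<partial>lborel)"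
proof -
  have [measurable]: "g \<in> borel_measurable borel" using g by auto
  define W where "W v = exp (- (v / c)\<^sup>2 / 2)" for v
  define h where "h v = (LINT s|lborel. g s * iexp (- (s * v)))" for v
  define \<gamma> where "\<gamma> s t = c * sqrt (2 * pi) * exp (- (c * (s - t))\<^sup>2 / 2)" for s t
  define B where "B = (LINT s|lborel. cmod (g s))"
  have W: "integrable lborel W" unfolding W_def by (rule gaussian_fourier(1)[OF c])
  have [measurable]: "W \<in> borel_measurable borel" "h \<in> borel_measurable borel"
    unfolding W_def h_def by measurable
  have hB: "cmod (h v) \<le> B" for v unfolding h_def B_def by (rule norm_fourier_le)
  have W0: "0 \<le> W v" for v by (simp add: W_def)
  have int: "integrable lborel (\<lambda>v. W v * (cmod (h v))\<^sup>2)"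
    by (rule Bochner_Integration.integrable_bound[of _ "\<lambda>v. W v * B\<^sup>2"])
       (use W W0 hB in \<open>auto intro!: AE_I2 mult_left_mono power_mono\<close>)
  define L where "L = (LINT v|lborel. W v * (cmod (h v))\<^sup>2)"
  have "0 \<le> L" unfolding L_def using W0 by (intro Bochner_Integration.integral_nonneg) auto
  have nn: "(\<integral>\<^sup>+v. ennreal (W v * (cmod (h v))\<^sup>2) \<partial>lborel) = ennreal L"
    unfolding L_def using int W0 by (intro nn_integral_eq_integral) auto
  have "complex_of_real L = (LINT v|lborel. complex_of_real (W v * (cmod (h v))\<^sup>2))"
    unfolding L_def by (rule integral_complex_of_real[symmetric])
  \<comment> \<open>Only one of the two factors of the squared modulus is expanded here. The other
    stays, bounded by \<open>B\<close>, until \<open>integral_fourier_gaussian\<close> expands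
    it.\<close>
  also have "\<dots> = (LINT v|lborel. LINT s|lborel. g s * (complex_of_real (W v) * iexp (- (s * v)) * cnj (h v)))"
  proof (intro Bochner_Integration.integral_cong refl)
    fix v
    have "complex_of_real (W v * (cmod (h v))\<^sup>2) = h v * (complex_of_real (W v) * cnj (h v))"
      by (simp add: complex_norm_square mult_ac flip: of_real_power)
    also have "\<dots> = (LINT s|lborel. (g s * iexp (- (s * v))) * (complex_of_real (W v) * cnj (h v)))"
      by (simp only: integral_mult_left_zero h_def)
    finally show "complex_of_real (W v * (cmod (h v))\<^sup>2) = (LINT s|lborel. g s * (complex_of_real (W v) * iexp (- (s * v)) * cnj (h v)))"
      by (simp add: mult_ac)
  qed
  also have "\<dots> = (LINT s|lborel. LINT v|lborel. g s * (complex_of_real (W v) * iexp (- (s * v)) * cnj (h v)))"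
  proof (rule lborel_pair.Fubini_integral, rule integrable_pair_bound)
    show "integrable lborel (\<lambda>s. cmod (g s) * B)" using g by simp
    show "integrable lborel W" by (rule W)
    show "cmod (case (s, v) of (s, v) \<Rightarrow> g s * (complex_of_real (W v) * iexp (- (s * v)) * cnj (h v))) \<le> cmod (g s) * B * W v" for s v
    proof -
      have "W v * cmod (g s) * cmod (h v) \<le> W v * cmod (g s) * B"
        using W0[of v] hB[of v] by (intro mult_left_mono) auto
      then show ?thesis using W0[of v] by (simp add: norm_mult mult_ac)
    qed
  qed measurable
  also have "\<dots> = (LINT s|lborel. g s * (LINT t|lborel. cnj (g t) * complex_of_real (\<gamma> s t)))"
    using integral_fourier_gaussian[OF g c] by (simp only: integral_mult_right_zero W_def h_def \<gamma>_def)
  finally have "ennreal L = ennreal (cmod (LINT s|lborel. g s * (LINT t|lborel. cnj (g t) * complex_of_real (\<gamma> s t))))"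
    using \<open>0 \<le> L\<close> by (metis abs_of_nonneg norm_of_real)
  also have "\<dots> \<le> (\<integral>\<^sup>+s. ennreal (cmod (g s * (LINT t|lborel. cnj (g t) * complex_of_real (\<gamma> s t)))) \<partial>lborel)"
    by (rule norm_integral_le_nn_integral)
  also have "\<dots> \<le> (\<integral>\<^sup>+s. \<integral>\<^sup>+t. ennreal (cmod (g s) * cmod (g t) * \<gamma> s t) \<partial>lborel \<partial>lborel)"
  proof (rule nn_integral_mono)
    fix s
    have "ennreal (cmod (g s * (LINT t|lborel. cnj (g t) * complex_of_real (\<gamma> s t)))) =
        ennreal (cmod (LINT t|lborel. g s * (cnj (g t) * complex_of_real (\<gamma> s t))))"
      by simp
    also have "\<dots> \<le> (\<integral>\<^sup>+t. ennreal (cmod (g s * (cnj (g t) * complex_of_real (\<gamma> s t)))) \<partial>lborel)"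
      by (rule norm_integral_le_nn_integral)
    also have "\<dots> = (\<integral>\<^sup>+t. ennreal (cmod (g s) * cmod (g t) * \<gamma> s t) \<partial>lborel)"
      using c by (simp add: norm_mult \<gamma>_def mult_ac)
    finally show "ennreal (cmod (g s * (LINT t|lborel. cnj (g t) * complex_of_real (\<gamma> s t)))) \<le> \<dots>" .
  qed
  also have "\<dots> \<le> ennreal (2 * pi) * (\<integral>\<^sup>+s. ennreal ((cmod (g s))\<^sup>2) \<partial>lborel)"
    unfolding \<gamma>_def by (rule nn_integral_gaussian_form_le[OF _ c]) auto
  finally show ?thesis using nn by (simp only: W_def h_def)
qed

text \<open>Fatou's lemma along \<open>c = n + 1\<close>: the Gaussian weights tend to 1 pointwise,
  while the bound of \<open>fourier_L2_gaussian_bound\<close> is independent of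
  \<open>c\<close>.\<close>

lemma fourier_L2_bound:
  fixes g :: "real \<Rightarrow> complex"
  assumes g: "integrable lborel g"
  shows "(\<integral>\<^sup>+v. ennreal ((cmod (LINT s|lborel. g s * iexp (- (s * v))))\<^sup>2) \<partial>lborel)
     \<le> ennreal (2 * pi) * (\<integral>\<^sup>+s. ennreal ((cmod (g s))\<^sup>2) \<partial>lborel)"
proof -
  have [measurable]: "g \<in> borel_measurable borel" using g by auto
  define h where "h v = (LINT s|lborel. g s * iexp (- (s * v)))" for v
  have [measurable]: "h \<in> borel_measurable borel" unfolding h_def by measurable
  define u where "u n v = ennreal (exp (- (v / real (Suc n))\<^sup>2 / 2) * (cmod (h v))\<^sup>2)" for n v
  have lim: "liminf (\<lambda>n. u n v) = ennreal ((cmod (h v))\<^sup>2)" for v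
  proof (rule lim_imp_Liminf)
    have "(\<lambda>n. exp (- (v * inverse (real (Suc n)))\<^sup>2 / 2) * (cmod (h v))\<^sup>2) \<longlonglongrightarrow> exp (- (v * 0)\<^sup>2 / 2) * (cmod (h v))\<^sup>2"
      by (intro tendsto_intros LIMSEQ_inverse_real_of_nat) simp
    then show "(\<lambda>n. u n v) \<longlonglongrightarrow> ennreal ((cmod (h v))\<^sup>2)"
      unfolding u_def divide_inverse[of v] by (intro tendsto_ennrealI) simp
  qed simp
  have "(\<integral>\<^sup>+v. ennreal ((cmod (h v))\<^sup>2) \<partial>lborel) = (\<integral>\<^sup>+v. liminf (\<lambda>n. u n v) \<partial>lborel)"
    by (simp add: lim)
  also have "\<dots> \<le> liminf (\<lambda>n. \<integral>\<^sup>+v. u n v \<partial>lborel)"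
    by (rule nn_integral_liminf) (simp add: u_def)
  also have "\<dots> \<le> liminf (\<lambda>n::nat. ennreal (2 * pi) * (\<integral>\<^sup>+s. ennreal ((cmod (g s))\<^sup>2) \<partial>lborel))"
    unfolding u_def h_def
    by (intro Liminf_mono always_eventually allI fourier_L2_gaussian_bound[OF g]) simp
  also have "\<dots> = ennreal (2 * pi) * (\<integral>\<^sup>+s. ennreal ((cmod (g s))\<^sup>2) \<partial>lborel)"
    by (simp add: Liminf_const)
  finally show ?thesis unfolding h_def .
qed

section \<open>Contour integrals over rectangles\<close>

text \<open>The counterclockwise boundary integral, split into Lebesgue integrals so that the
  horizontal edges can be estimated and the vertical ones recognized as transforms along
  lines.\<close>

definition rectangle_integral :: "(complex \<Rightarrow> complex) \<Rightarrow> real \<Rightarrow> real \<Rightarrow> real \<Rightarrow> complex" where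
  "rectangle_integral f a b T =
     (LINT s|lborel. indicator {a..b} s *\<^sub>R f (Complex s (- T)))
     + \<i> * (LINT v|lborel. indicator {-T..T} v *\<^sub>R f (Complex b v))
     - (LINT s|lborel. indicator {a..b} s *\<^sub>R f (Complex s T))
     - \<i> * (LINT v|lborel. indicator {-T..T} v *\<^sub>R f (Complex a v))"

lemma continuous_on_Complex [continuous_intros]:
  assumes "continuous_on S f" "continuous_on S g"
  shows "continuous_on S (\<lambda>x. Complex (f x) (g x))"
  unfolding Complex_eq by (intro continuous_intros assms)

lemma contour_integral_vertical:
  assumes "continuous_on {c..d} (\<lambda>v. f (Complex x v))" "c < d"
  shows "contour_integral (linepath (Complex x c) (Complex x d)) f =
      \<i> * (LINT v|lborel. indicator {c..d} v *\<^sub>R f (Complex x v))"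
  using contour_integral_linepath_same_Re[of "Complex x c" x "Complex x d" c d f] assms
    set_borel_integral_eq_integral(2)[OF borel_integrable_atLeastAtMost'[OF assms(1)]]
  by (simp add: set_lebesgue_integral_def)

lemma contour_integral_horizontal:
  assumes "continuous_on {a..b} (\<lambda>s. f (Complex s y))" "a < b"
  shows "contour_integral (linepath (Complex a y) (Complex b y)) f =
      (LINT s|lborel. indicator {a..b} s *\<^sub>R f (Complex s y))"
proof -
  have int: "((\<lambda>x. f (of_real x + \<i> * of_real y)) has_integral integral {a..b} (\<lambda>x. f (Complex x y))) {a..b}"
    using integrable_continuous_real[OF assms(1)] by (simp add: Complex_eq has_integral_integral)
  have "(f has_contour_integral integral {a..b} (\<lambda>x. f (Complex x y))) (linepath (Complex a y) (Complex b y))"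
  proof -
    have "linepath (Complex a y) (Complex b y) t = linepath (of_real a) (of_real b) t + \<i> * of_real y" for t
      by (auto simp: linepath_def complex_eq_iff algebra_simps)
    moreover have "Complex b y - Complex a y = of_real b - of_real a"
      by (auto simp: complex_eq_iff)
    ultimately have "(f has_contour_integral I) (linepath (Complex a y) (Complex b y)) \<longleftrightarrow>
        ((\<lambda>w. f (w + \<i> * of_real y)) has_contour_integral I) (linepath (of_real a) (of_real b))" for I
      by (simp add: has_contour_integral_linepath)
    then show ?thesis
      using int assms(2) by (simp add: has_contour_integral_linepath_Reals_iff)
  qed
  then have "contour_integral (linepath (Complex a y) (Complex b y)) f = integral {a..b} (\<lambda>x. f (Complex x y))"
    by (rule contour_integral_unique)
  then show ?thesis
    using set_borel_integral_eq_integral(2)[OF borel_integrable_atLeastAtMost'[OF assms(1)]]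
    by (simp add: set_lebesgue_integral_def)
qed

text \<open>Continuity is asked for on the boundary only, which admits the integrand of Cauchy's
  formula with its pole inside.\<close>

lemma contour_integral_rectpath_eq:
  assumes "a < b" "0 < T"
    and cont: "continuous_on (path_image (rectpath (Complex a (-T)) (Complex b T))) f"
  shows "contour_integral (rectpath (Complex a (-T)) (Complex b T)) f = rectangle_integral f a b T"
proof -
  have img: "path_image (rectpath (Complex a (-T)) (Complex b T)) =
      {z. Re z \<in> {a, b} \<and> Im z \<in> {-T..T}} \<union> {z. Im z \<in> {-T, T} \<and> Re z \<in> {a..b}}"
    using assms by (subst path_image_rectpath) auto
  have ver: "continuous_on {-T..T} (\<lambda>v. f (Complex x v))" if "x \<in> {a, b}" for x
    by (rule continuous_on_compose2[OF cont])
       (use that in \<open>auto simp: img intro!: continuous_intros\<close>)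
  have hor: "continuous_on {a..b} (\<lambda>s. f (Complex s y))" if "y \<in> {-T, T}" for y
    by (rule continuous_on_compose2[OF cont])
       (use that in \<open>auto simp: img intro!: continuous_intros\<close>)
  have "closed_segment (Complex a (-T)) (Complex b (-T)) \<subseteq> path_image (rectpath (Complex a (-T)) (Complex b T))"
    "closed_segment (Complex b (-T)) (Complex b T) \<subseteq> path_image (rectpath (Complex a (-T)) (Complex b T))"
    "closed_segment (Complex b T) (Complex a T) \<subseteq> path_image (rectpath (Complex a (-T)) (Complex b T))"
    "closed_segment (Complex a T) (Complex a (-T)) \<subseteq> path_image (rectpath (Complex a (-T)) (Complex b T))"
    using assms by (auto simp: img closed_segment_same_Im closed_segment_same_Re closed_segment_eq_real_ivl)
  then have ci: "f contour_integrable_on linepath (Complex a (-T)) (Complex b (-T))"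
    "f contour_integrable_on linepath (Complex b (-T)) (Complex b T)"
    "f contour_integrable_on linepath (Complex b T) (Complex a T)"
    "f contour_integrable_on linepath (Complex a T) (Complex a (-T))"
    by (auto intro!: contour_integrable_continuous_linepath continuous_on_subset[OF cont])
  have "contour_integral (rectpath (Complex a (-T)) (Complex b T)) f =
      contour_integral (linepath (Complex a (-T)) (Complex b (-T))) f +
      contour_integral (linepath (Complex b (-T)) (Complex b T)) f +
      contour_integral (linepath (Complex b T) (Complex a T)) f +
      contour_integral (linepath (Complex a T) (Complex a (-T))) f"
    using ci by (simp add: rectpath_def Let_def contour_integral_join contour_integrable_join valid_path_join add.assoc)
  also have "contour_integral (linepath (Complex b T) (Complex a T)) f =
      - contour_integral (linepath (Complex a T) (Complex b T)) f"
    using ci(3) by (metis contour_integral_reversepath reversepath_linepath valid_path_linepath minus_minus)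
  also have "contour_integral (linepath (Complex a T) (Complex a (-T))) f =
      - contour_integral (linepath (Complex a (-T)) (Complex a T)) f"
    using ci(4) by (metis contour_integral_reversepath reversepath_linepath valid_path_linepath minus_minus)
  finally show ?thesis
    using assms(1,2) hor ver
    by (simp add: contour_integral_vertical contour_integral_horizontal rectangle_integral_def)
qed

lemma rectangle_integral_holomorphic:
  assumes "f holomorphic_on UNIV" "a < b" "0 < T"
  shows "rectangle_integral f a b T = 0"
proof -
  have "(f has_contour_integral 0) (rectpath (Complex a (-T)) (Complex b T))"
    using assms by (intro Cauchy_theorem_convex_simple[of _ UNIV]) auto
  then show ?thesis
    using assms contour_integral_rectpath_eq[of a b T f]
    by (metis contour_integral_unique continuous_on_subset holomorphic_on_imp_continuous_on subset_UNIV)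
qed

lemma rectangle_integral_Cauchy_formula:
  assumes f: "f holomorphic_on UNIV" and z: "a < Re z" "Re z < b" "\<bar>Im z\<bar> < T"
  shows "rectangle_integral (\<lambda>w. f w / (w - z)) a b T = 2 * pi * \<i> * f z"
proof -
  let ?p = "rectpath (Complex a (-T)) (Complex b T)"
  have zbox: "z \<in> box (Complex a (-T)) (Complex b T)"
    using z by (auto simp: in_box_complex_iff)
  have nz: "z \<notin> path_image ?p"
    using z zbox by (subst path_image_rectpath_cbox_minus_box) auto
  have "((\<lambda>w. f w / (w - z)) has_contour_integral (2 * pi * \<i> * winding_number ?p z * f z)) ?p"
    using nz by (intro Cauchy_integral_formula_convex_simple[of UNIV] f) auto
  then have "contour_integral ?p (\<lambda>w. f w / (w - z)) = 2 * pi * \<i> * f z"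
    using winding_number_rectpath[OF zbox] by (simp add: contour_integral_unique)
  moreover have "continuous_on (path_image ?p) (\<lambda>w. f w / (w - z))"
    using nz f by (intro continuous_intros continuous_on_subset[OF holomorphic_on_imp_continuous_on[OF f]]) auto
  ultimately show ?thesis
    using z by (subst contour_integral_rectpath_eq[symmetric]) auto
qed

text \<open>This formula trades the Cauchy kernel \<open>1 / s\<close> for a superposition of
  exponentials. The antiderivative \<open>- exp (- \<eta> * s) / s\<close> is evaluated at 0 and at
  infinity, where \<open>0 < Re s\<close> makes it vanish.\<close>

lemma exp_half_line:
  fixes s :: complex
  assumes "0 < Re s"
  shows "integrable lborel (\<lambda>\<eta>. indicator {0<..} \<eta> *\<^sub>R exp (- (complex_of_real \<eta> * s)))"
    and "(LINT \<eta>|lborel. indicator {0<..} \<eta> *\<^sub>R exp (- (complex_of_real \<eta> * s))) = 1 / s"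
proof -
  have r: "(\<lambda>\<eta>. exp (- Re s * \<eta>)) absolutely_integrable_on {0..}"
    using has_integral_exp_minus_to_infinity[OF assms, of 0] 
    by (intro nonnegative_absolutely_integrable_1) (auto simp: integrable_on_def)
  \<comment> \<open>Absolute integrability refers to the completed measure; Borel measurability of
    the integrand allows the return to \<open>lborel\<close>.\<close>
  then have "set_integrable lborel {0..} (\<lambda>\<eta>. exp (- Re s * \<eta>))"
    unfolding absolutely_integrable_on_def set_integrable_def
    by (subst (asm) integrable_completion) auto
  then have si: "set_integrable lborel {0<..} (\<lambda>\<eta>. exp (- Re s * \<eta>))"
    by (rule set_integrable_subset) auto
  show int: "integrable lborel (\<lambda>\<eta>. indicator {0<..} \<eta> *\<^sub>R exp (- (complex_of_real \<eta> * s)))"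
    by (rule Bochner_Integration.integrable_bound[OF si[unfolded set_integrable_def]])
       (auto simp: indicator_def mult.commute)
  have lim: "((\<lambda>x. - exp (- (complex_of_real x * s)) / s) \<longlongrightarrow> 0) at_top"
  proof (rule tendsto_norm_zero_cancel)
    have "((\<lambda>x. exp (- (Re s * x)) / cmod s) \<longlongrightarrow> 0 / cmod s) at_top"
      using assms
      by (intro tendsto_divide tendsto_const filterlim_compose[OF exp_at_bot]
            filterlim_compose[OF filterlim_uminus_at_bot_at_top]
            filterlim_tendsto_pos_mult_at_top[OF tendsto_const] filterlim_ident) auto
    then show "((\<lambda>x. cmod (- exp (- (complex_of_real x * s)) / s)) \<longlongrightarrow> 0) at_top"
      by (simp add: norm_divide mult.commute)
  qed
  have s: "s \<noteq> 0" using assms by auto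
  have "(LBINT x=0..\<infinity>. exp (- (complex_of_real x * s))) = 0 - (- exp (- (complex_of_real 0 * s)) / s)"
  proof (rule interval_integral_FTC_integrable)
    show "((\<lambda>x. - exp (- (complex_of_real x * s)) / s) has_vector_derivative exp (- (complex_of_real x * s))) (at x)" for x
      using s by (auto intro!: derivative_eq_intros has_vector_derivative_real_field)
    show "set_integrable lborel (einterval 0 \<infinity>) (\<lambda>x. exp (- (complex_of_real x * s)))"
      using int by (simp add: set_integrable_def einterval_def greaterThan_def zero_ereal_def)
    show "(((\<lambda>x. - exp (- (complex_of_real x * s)) / s) \<circ> real_of_ereal) \<longlongrightarrow> - exp (- (complex_of_real 0 * s)) / s) (at_right 0)"
      unfolding zero_ereal_def
      by (subst ereal_tendsto_simps, intro tendsto_intros) (use s in auto)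
    show "(((\<lambda>x. - exp (- (complex_of_real x * s)) / s) \<circ> real_of_ereal) \<longlongrightarrow> 0) (at_left \<infinity>)"
      using lim by (subst ereal_tendsto_simps)
  qed auto
  then show "(LINT \<eta>|lborel. indicator {0<..} \<eta> *\<^sub>R exp (- (complex_of_real \<eta> * s))) = 1 / s"
    by (simp add: interval_lebesgue_integral_0_infty set_lebesgue_integral_def)
qed

section \<open>The Laplace kernel of a weight\<close>

lemma integrable_exp_neg_abs:
  assumes "0 < (d::real)"
  shows "integrable lborel (\<lambda>x. exp (- (d * \<bar>x\<bar>)))"
proof -
  define f where "f x = indicator {0<..} x *\<^sub>R exp (- (x * d))" for x :: real
  have "integrable lborel (\<lambda>x. norm (indicator {0<..} x *\<^sub>R exp (- (complex_of_real x * complex_of_real d))))"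
    using assms by (intro integrable_norm exp_half_line(1)) simp
  then have f: "integrable lborel f"
    by (rule Bochner_Integration.integrable_cong[THEN iffD1, rotated 2])
       (auto simp: f_def norm_exp_eq_Re)
  have f': "integrable lborel (\<lambda>x. f (- x))"
    using lborel_integrable_real_affine[OF f, of "-1" 0] by simp
  show ?thesis
  proof (rule Bochner_Integration.integrable_bound[OF Bochner_Integration.integrable_add[OF f f']])
    \<comment> \<open>Both half-line pieces vanish at 0, where the domination fails.\<close>
    have "AE x in lborel. x \<noteq> (0::real)" by (rule AE_lborel_singleton)
    then show "AE x in lborel. norm (exp (- (d * \<bar>x\<bar>))) \<le> norm (f x + f (- x))"
      by eventually_elim (auto simp: f_def indicator_def abs_if mult.commute)
  qed measurable
qed

lemma exp_le_exp_abs: "exp (R * \<eta>) \<le> exp (\<bar>R\<bar> * \<bar>\<eta>\<bar>)" for R \<eta> :: real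
  by (simp add: abs_mult[symmetric])

definition laplace_integral :: "(real \<Rightarrow> real) \<Rightarrow> real \<Rightarrow> real" where
  "laplace_integral \<phi> \<eta> = (LINT r|lborel. exp (2 * (r * \<eta> - \<phi> r)))"

definition laplace_kernel :: "(real \<Rightarrow> real) \<Rightarrow> complex \<Rightarrow> complex" where
  "laplace_kernel \<phi> s = complex_of_real (1 / (2 * pi)) *
     (LINT \<eta>|lborel. exp (complex_of_real \<eta> * s) / complex_of_real (laplace_integral \<phi> \<eta>))"

text \<open>Here \<open>\<phi>\<close> plays the role of \<open>\<tau> * p\<close> on the real axis,
  so that the parameter disappears from the analysis; \<open>laplace_weight_scaled\<close> brings it
  back.\<close>

locale laplace_weight =
  fixes \<phi> :: "real \<Rightarrow> real"
  assumes continuous: "continuous_on UNIV \<phi>"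
    and integrable_tilt: "\<And>\<eta>. integrable lborel (\<lambda>r. exp (2 * (r * \<eta> - \<phi> r)))"
begin

abbreviation "G \<equiv> laplace_integral \<phi>"

lemma phi_measurable [measurable]: "\<phi> \<in> borel_measurable borel"
  using continuous by (rule borel_measurable_continuous_onI)

lemma G_measurable [measurable]: "G \<in> borel_measurable borel"
  unfolding laplace_integral_def by measurable

text \<open>On the interval from \<open>R / 2\<close> to \<open>R / 2 + 1\<close>, or on its mirror
  image when \<open>\<eta> < 0\<close>, one has \<open>2 * r * \<eta> >= R * |\<eta>|\<close> and
  \<open>\<phi>\<close> is bounded. Hence \<open>G\<close> outgrows every exponential.\<close>

lemma G_lower_bound:
  assumes "0 \<le> R"
  obtains c where "0 < c" "\<And>\<eta>. c * exp (R * \<bar>\<eta>\<bar>) \<le> G \<eta>"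
proof -
  have "compact (\<phi> ` {- R / 2 - 1..R / 2 + 1})"
    by (intro compact_continuous_image continuous_on_subset[OF continuous]) auto
  then have "bounded (\<phi> ` {- R / 2 - 1..R / 2 + 1})"
    by (rule compact_imp_bounded)
  then obtain M where M: "\<And>r. r \<in> {- R / 2 - 1..R / 2 + 1} \<Longrightarrow> \<bar>\<phi> r\<bar> \<le> M"
    unfolding bounded_iff by (metis imageI real_norm_def)
  show thesis
  proof (rule that)
    fix \<eta> :: real
    define \<alpha> where "\<alpha> = (if 0 \<le> \<eta> then R / 2 else - R / 2 - 1)"
    define c where "c = exp (- 2 * M) * exp (R * \<bar>\<eta>\<bar>)"
    have "c = (LINT r|lborel. indicator {\<alpha>..\<alpha> + 1} r *\<^sub>R c)"
      by simp
    also have "\<dots> \<le> G \<eta>"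
      unfolding laplace_integral_def
    proof (rule integral_mono)
      fix r :: real
      show "indicator {\<alpha>..\<alpha> + 1} r *\<^sub>R c \<le> exp (2 * (r * \<eta> - \<phi> r))"
      proof (cases "r \<in> {\<alpha>..\<alpha> + 1}")
        case True
        have "\<phi> r \<le> M"
          using M[of r] True assms by (auto simp: \<alpha>_def split: if_splits)
        moreover have "R * \<bar>\<eta>\<bar> \<le> 2 * r * \<eta>"
        proof (cases "0 \<le> \<eta>")
          case p: True
          then have "R * \<eta> \<le> (2 * r) * \<eta>"
            using True by (intro mult_right_mono) (auto simp: \<alpha>_def)
          then show ?thesis using p by simp
        next
          case n: False
          then have "R * (- \<eta>) \<le> (- 2 * r) * (- \<eta>)"
            using True by (intro mult_right_mono) (auto simp: \<alpha>_def)
          then show ?thesis using n by simp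
        qed
        ultimately show ?thesis using True by (simp add: c_def exp_add[symmetric] algebra_simps)
      qed simp
    qed (use integrable_tilt in auto)
    finally show "exp (- 2 * M) * exp (R * \<bar>\<eta>\<bar>) \<le> G \<eta>" unfolding c_def .
  qed simp
qed

lemma G_pos: "0 < G \<eta>"
  using G_lower_bound[of 0] by (metis exp_gt_zero less_le_trans mult_pos_pos order_refl)

lemma nn_integral_tilt: "(\<integral>\<^sup>+r. ennreal (exp (2 * (r * \<eta> - \<phi> r))) \<partial>lborel) = ennreal (G \<eta>)"
  unfolding laplace_integral_def using integrable_tilt by (intro nn_integral_eq_integral) auto

lemma integrable_exp_abs_div_G: "integrable lborel (\<lambda>\<eta>. exp (R * \<bar>\<eta>\<bar>) / G \<eta>)"
proof -
  \<comment> \<open>One spare unit in the growth rate of \<open>G\<close> leaves the integrable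
    factor \<open>exp (- |\<eta>|)\<close>.\<close>
  obtain c where c: "0 < c" "\<And>\<eta>. c * exp ((\<bar>R\<bar> + 1) * \<bar>\<eta>\<bar>) \<le> G \<eta>"
    using G_lower_bound[of "\<bar>R\<bar> + 1"] by auto
  show ?thesis
  proof (rule Bochner_Integration.integrable_bound)
    show "integrable lborel (\<lambda>\<eta>::real. exp (- (1 * \<bar>\<eta>\<bar>)) / c)"
      by (intro integrable_divide_zero integrable_exp_neg_abs) simp
    show "AE \<eta> in lborel. norm (exp (R * \<bar>\<eta>\<bar>) / G \<eta>) \<le> norm (exp (- (1 * \<bar>\<eta>\<bar>)) / c)"
    proof (rule AE_I2)
      fix \<eta> :: real
      have "R * \<bar>\<eta>\<bar> \<le> \<bar>R\<bar> * \<bar>\<eta>\<bar>" by (intro mult_right_mono) auto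
      then have "exp (R * \<bar>\<eta>\<bar>) * c \<le> exp (- \<bar>\<eta>\<bar>) * (c * exp ((\<bar>R\<bar> + 1) * \<bar>\<eta>\<bar>))"
        using c(1) by (simp add: exp_add[symmetric] algebra_simps)
      also have "\<dots> \<le> exp (- \<bar>\<eta>\<bar>) * G \<eta>" by (intro mult_left_mono c) auto
      finally show "norm (exp (R * \<bar>\<eta>\<bar>) / G \<eta>) \<le> norm (exp (- (1 * \<bar>\<eta>\<bar>)) / c)"
        using c(1) G_pos[of \<eta>] by (simp add: field_simps)
    qed
  qed measurable
qed

lemma integrable_exp_div_G:
  "integrable lborel (\<lambda>\<eta>. exp (complex_of_real \<eta> * s) / complex_of_real (G \<eta>))"
proof (rule Bochner_Integration.integrable_bound[OF integrable_exp_abs_div_G[of "\<bar>Re s\<bar>"]])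
  show "AE \<eta> in lborel. norm (exp (complex_of_real \<eta> * s) / complex_of_real (G \<eta>)) \<le> norm (exp (\<bar>Re s\<bar> * \<bar>\<eta>\<bar>) / G \<eta>)"
    using G_pos exp_le_exp_abs[of "Re s"]
    by (intro AE_I2) (simp add: norm_divide less_imp_le divide_right_mono mult.commute)
qed measurable

text \<open>Term by term integration of the exponential series, dominated by
  \<open>exp (cmod s * |\<eta>|) / G \<eta>\<close>. Being an everywhere convergent power series,
  the kernel is entire.\<close>

lemma laplace_kernel_sums:
  "(\<lambda>n. complex_of_real (1 / (2 * pi)) *
      (LINT \<eta>|lborel. complex_of_real \<eta> ^ n / fact n / complex_of_real (G \<eta>)) * s ^ n) sums laplace_kernel \<phi> s"
proof -
  define F where "F n \<eta> = (complex_of_real \<eta> * s) ^ n / fact n / complex_of_real (G \<eta>)" for n \<eta>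
  have [measurable]: "F n \<in> borel_measurable borel" for n unfolding F_def by measurable
  have normF: "norm (F n \<eta>) = (\<bar>\<eta>\<bar> * cmod s) ^ n / fact n / G \<eta>" for n \<eta>
    using G_pos[of \<eta>] by (simp add: F_def norm_divide norm_power norm_mult)
  have partial: "(\<Sum>n\<in>A. norm (F n \<eta>)) \<le> exp (cmod s * \<bar>\<eta>\<bar>) / G \<eta>" if "finite A" for A \<eta>
  proof -
    have "(\<Sum>n\<in>A. (\<bar>\<eta>\<bar> * cmod s) ^ n / fact n) \<le> exp (\<bar>\<eta>\<bar> * cmod s)"
      using sum_le_suminf[OF summable_exp_generic[of "\<bar>\<eta>\<bar> * cmod s"] that]
      by (simp add: exp_def divide_inverse mult.commute)
    then have "(\<Sum>n\<in>A. (\<bar>\<eta>\<bar> * cmod s) ^ n / fact n) / G \<eta> \<le> exp (\<bar>\<eta>\<bar> * cmod s) / G \<eta>"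
      using G_pos[of \<eta>] by (intro divide_right_mono) auto
    then show ?thesis
      by (simp only: normF sum_divide_distrib mult.commute[of "cmod s"])
  qed
  have int: "integrable lborel (F n)" for n
    by (rule Bochner_Integration.integrable_bound[OF integrable_exp_abs_div_G[of "cmod s"]])
       (use partial[of "{n}"] G_pos in \<open>auto intro!: AE_I2 simp: less_imp_le\<close>)
  have "(\<lambda>n. LINT \<eta>|lborel. F n \<eta>) sums (LINT \<eta>|lborel. (\<Sum>n. F n \<eta>))"
  proof (rule sums_integral[OF int])
    show "AE \<eta> in lborel. summable (\<lambda>n. norm (F n \<eta>))"
      by (intro AE_I2, rule summableI_nonneg_bounded[OF _ partial]) auto
    show "summable (\<lambda>n. LINT \<eta>|lborel. norm (F n \<eta>))"
    proof (rule summableI_nonneg_bounded)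
      fix n
      have "(\<Sum>i<n. LINT \<eta>|lborel. norm (F i \<eta>)) = (LINT \<eta>|lborel. (\<Sum>i<n. norm (F i \<eta>)))"
        using int by (subst Bochner_Integration.integral_sum) auto
      also have "\<dots> \<le> (LINT \<eta>|lborel. exp (cmod s * \<bar>\<eta>\<bar>) / G \<eta>)"
        using int by (intro integral_mono partial integrable_exp_abs_div_G) auto
      finally show "(\<Sum>i<n. LINT \<eta>|lborel. norm (F i \<eta>)) \<le> \<dots>" .
    qed simp
  qed
  also have "(\<lambda>\<eta>. \<Sum>n. F n \<eta>) = (\<lambda>\<eta>. exp (complex_of_real \<eta> * s) / complex_of_real (G \<eta>))"
  proof
    fix \<eta>
    have "(\<lambda>n. (complex_of_real \<eta> * s) ^ n / fact n) sums exp (complex_of_real \<eta> * s)"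
      using exp_converges[of "complex_of_real \<eta> * s"] by (simp add: scaleR_conv_of_real field_simps)
    from sums_divide[OF this, of "complex_of_real (G \<eta>)"]
    show "(\<Sum>n. F n \<eta>) = exp (complex_of_real \<eta> * s) / complex_of_real (G \<eta>)"
      unfolding F_def by (rule sums_unique[symmetric])
  qed
  finally have "(\<lambda>n. complex_of_real (1 / (2 * pi)) * (LINT \<eta>|lborel. F n \<eta>)) sums laplace_kernel \<phi> s"
    unfolding laplace_kernel_def by (rule sums_mult)
  moreover have "(LINT \<eta>|lborel. F n \<eta>) = (LINT \<eta>|lborel. complex_of_real \<eta> ^ n / fact n / complex_of_real (G \<eta>)) * s ^ n" for n
  proof -
    have "F n = (\<lambda>\<eta>. (complex_of_real \<eta> ^ n / fact n / complex_of_real (G \<eta>)) * s ^ n)"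
      by (simp add: F_def power_mult_distrib fun_eq_iff)
    then show ?thesis by (simp only: integral_mult_left_zero)
  qed
  ultimately show ?thesis by (simp only: mult.assoc)
qed

lemma laplace_kernel_holomorphic: "laplace_kernel \<phi> holomorphic_on UNIV"
proof -
  have "laplace_kernel \<phi> holomorphic_on ball 0 r" for r
    by (rule power_series_holomorphic, unfold diff_zero) (rule laplace_kernel_sums)
  then have "laplace_kernel \<phi> holomorphic_on (\<Union>r. ball 0 r)"
    by (intro holomorphic_on_UN_open) auto
  also have "(\<Union>r. ball 0 r) = (UNIV :: complex set)"
    by (auto intro: gt_ex)
  finally show ?thesis .
qed

lemma laplace_kernel_measurable [measurable]: "laplace_kernel \<phi> \<in> borel_measurable borel"
  by (intro borel_measurable_continuous_onI holomorphic_on_imp_continuous_on laplace_kernel_holomorphic)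

text \<open>On the line \<open>Re w = u\<close> the kernel is \<open>1 / (2 * pi)\<close> times the
  Fourier transform of \<open>g\<close>; Plancherel's inequality then gives the constant
  \<open>2 * pi / (2 * pi)^2\<close>.\<close>

lemma laplace_kernel_vertical_L2:
  "(\<integral>\<^sup>+v. ennreal ((cmod (laplace_kernel \<phi> (z + cnj (Complex u v))))\<^sup>2) \<partial>lborel)
    \<le> (\<integral>\<^sup>+\<eta>. ennreal (exp (2 * (Re z + u) * \<eta>) / (2 * pi * (G \<eta>)\<^sup>2)) \<partial>lborel)"
proof -
  define g where "g \<eta> = exp (complex_of_real \<eta> * (z + complex_of_real u)) / complex_of_real (G \<eta>)" for \<eta>
  have g: "integrable lborel g" unfolding g_def by (rule integrable_exp_div_G)
  have [measurable]: "g \<in> borel_measurable borel" using g by auto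
  have "exp (complex_of_real \<eta> * (z + cnj (Complex u v))) / complex_of_real (G \<eta>) = g \<eta> * iexp (- (\<eta> * v))" for \<eta> v
    by (simp add: g_def exp_add[symmetric] Complex_eq algebra_simps)
  then have k: "laplace_kernel \<phi> (z + cnj (Complex u v)) =
      complex_of_real (1 / (2 * pi)) * (LINT \<eta>|lborel. g \<eta> * iexp (- (\<eta> * v)))" for v
    unfolding laplace_kernel_def by simp
  have "(\<integral>\<^sup>+v. ennreal ((cmod (laplace_kernel \<phi> (z + cnj (Complex u v))))\<^sup>2) \<partial>lborel) =
      ennreal (1 / (2 * pi)\<^sup>2) * (\<integral>\<^sup>+v. ennreal ((cmod (LINT \<eta>|lborel. g \<eta> * iexp (- (\<eta> * v))))\<^sup>2) \<partial>lborel)"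
    by (subst nn_integral_cmult[symmetric])
       (auto simp: k norm_mult norm_divide power_divide power_mult_distrib ennreal_mult'[symmetric] simp del: of_real_mult intro!: nn_integral_cong)
  also have "\<dots> \<le> ennreal (1 / (2 * pi)\<^sup>2) * (ennreal (2 * pi) * (\<integral>\<^sup>+\<eta>. ennreal ((cmod (g \<eta>))\<^sup>2) \<partial>lborel))"
    by (intro mult_left_mono fourier_L2_bound g) auto
  also have "\<dots> = (\<integral>\<^sup>+\<eta>. ennreal (1 / (2 * pi)) * ennreal ((cmod (g \<eta>))\<^sup>2) \<partial>lborel)"
    by (subst nn_integral_cmult, simp)
       (simp add: mult.assoc[symmetric] ennreal_mult'[symmetric] power2_eq_square)
  also have "\<dots> = (\<integral>\<^sup>+\<eta>. ennreal (exp (2 * (Re z + u) * \<eta>) / (2 * pi * (G \<eta>)\<^sup>2)) \<partial>lborel)"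
  proof (rule nn_integral_cong)
    fix \<eta>
    have "(cmod (g \<eta>))\<^sup>2 = exp (2 * (Re z + u) * \<eta>) / (G \<eta>)\<^sup>2"
      by (simp add: g_def norm_divide power_divide exp_double[symmetric] algebra_simps)
    then show "ennreal (1 / (2 * pi)) * ennreal ((cmod (g \<eta>))\<^sup>2) = ennreal (exp (2 * (Re z + u) * \<eta>) / (2 * pi * (G \<eta>)\<^sup>2))"
      by (simp add: ennreal_mult'[symmetric])
  qed
  finally show ?thesis .
qed

text \<open>The line bounds are integrated against \<open>exp (- 2 * \<phi> u)\<close> by Tonelli.
  The integral over \<open>u\<close> produces \<open>G \<eta>\<close>, which cancels one of the two
  such factors in the denominator, and what remains is integrable in \<open>\<eta>\<close>.\<close>

lemma laplace_kernel_L2: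
  "integrable lborel (\<lambda>w. (cmod (laplace_kernel \<phi> (z + cnj w)))\<^sup>2 * exp (- 2 * \<phi> (Re w)))"
proof (rule integrableI_bounded)
  have "(\<integral>\<^sup>+w. ennreal (norm ((cmod (laplace_kernel \<phi> (z + cnj w)))\<^sup>2 * exp (- 2 * \<phi> (Re w)))) \<partial>lborel)
      = (\<integral>\<^sup>+u. \<integral>\<^sup>+v. ennreal ((cmod (laplace_kernel \<phi> (z + cnj (Complex u v))))\<^sup>2) * ennreal (exp (- 2 * \<phi> u)) \<partial>lborel \<partial>lborel)"
    by (subst nn_integral_complex) (auto simp: ennreal_mult')
  also have "\<dots> = (\<integral>\<^sup>+u. (\<integral>\<^sup>+v. ennreal ((cmod (laplace_kernel \<phi> (z + cnj (Complex u v))))\<^sup>2) \<partial>lborel) * ennreal (exp (- 2 * \<phi> u)) \<partial>lborel)"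
    by (intro nn_integral_cong nn_integral_multc) measurable
  also have "\<dots> \<le> (\<integral>\<^sup>+u. (\<integral>\<^sup>+\<eta>. ennreal (exp (2 * (Re z + u) * \<eta>) / (2 * pi * (G \<eta>)\<^sup>2)) \<partial>lborel) * ennreal (exp (- 2 * \<phi> u)) \<partial>lborel)"
    by (intro nn_integral_mono mult_right_mono laplace_kernel_vertical_L2) auto
  also have "\<dots> = (\<integral>\<^sup>+u. \<integral>\<^sup>+\<eta>. ennreal (exp (2 * (Re z + u) * \<eta>) / (2 * pi * (G \<eta>)\<^sup>2)) * ennreal (exp (- 2 * \<phi> u)) \<partial>lborel \<partial>lborel)"
    by (intro nn_integral_cong nn_integral_multc[symmetric]) measurable
  also have "\<dots> = (\<integral>\<^sup>+\<eta>. \<integral>\<^sup>+u. ennreal (exp (2 * (Re z + u) * \<eta>) / (2 * pi * (G \<eta>)\<^sup>2)) * ennreal (exp (- 2 * \<phi> u)) \<partial>lborel \<partial>lborel)"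
    by (rule lborel_pair.Fubini'[symmetric]) measurable
  also have "\<dots> = (\<integral>\<^sup>+\<eta>. ennreal (exp (2 * Re z * \<eta>) / (2 * pi * G \<eta>)) \<partial>lborel)"
  proof (rule nn_integral_cong)
    fix \<eta>
    have "(\<integral>\<^sup>+u. ennreal (exp (2 * (Re z + u) * \<eta>) / (2 * pi * (G \<eta>)\<^sup>2)) * ennreal (exp (- 2 * \<phi> u)) \<partial>lborel)
       = (\<integral>\<^sup>+u. ennreal (exp (2 * Re z * \<eta>) / (2 * pi * (G \<eta>)\<^sup>2)) * ennreal (exp (2 * (u * \<eta> - \<phi> u))) \<partial>lborel)"
      by (intro nn_integral_cong)
         (simp add: ennreal_mult'[symmetric] exp_add[symmetric] algebra_simps)
    also have "\<dots> = ennreal (exp (2 * Re z * \<eta>) / (2 * pi * (G \<eta>)\<^sup>2)) * ennreal (G \<eta>)"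
      by (subst nn_integral_cmult, measurable) (simp only: nn_integral_tilt)
    also have "\<dots> = ennreal (exp (2 * Re z * \<eta>) / (2 * pi * G \<eta>))"
      using G_pos[of \<eta>] by (simp add: ennreal_mult'[symmetric] power2_eq_square)
    finally show "(\<integral>\<^sup>+u. ennreal (exp (2 * (Re z + u) * \<eta>) / (2 * pi * (G \<eta>)\<^sup>2)) * ennreal (exp (- 2 * \<phi> u)) \<partial>lborel)
       = ennreal (exp (2 * Re z * \<eta>) / (2 * pi * G \<eta>))" .
  qed
  also have "\<dots> \<le> (\<integral>\<^sup>+\<eta>. ennreal (norm (exp (\<bar>2 * Re z\<bar> * \<bar>\<eta>\<bar>) / G \<eta>)) \<partial>lborel)"
  proof (intro nn_integral_mono ennreal_leI)
    fix \<eta>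
    have "1 \<le> 2 * pi" using pi_ge_two by linarith
    then have "exp (2 * Re z * \<eta>) / (2 * pi * G \<eta>) \<le> exp (2 * Re z * \<eta>) / (1 * G \<eta>)"
      using G_pos[of \<eta>] by (intro divide_left_mono mult_right_mono mult_pos_pos) auto
    also have "\<dots> \<le> norm (exp (\<bar>2 * Re z\<bar> * \<bar>\<eta>\<bar>) / G \<eta>)"
      using G_pos[of \<eta>] exp_le_exp_abs[of "2 * Re z" \<eta>] by (simp add: divide_right_mono less_imp_le)
    finally show "exp (2 * Re z * \<eta>) / (2 * pi * G \<eta>) \<le> \<dots>" .
  qed
  also have "\<dots> < \<infinity>"
    using integrable_exp_abs_div_G[of "\<bar>2 * Re z\<bar>"] by (simp only: integrable_iff_bounded)
  finally show "(\<integral>\<^sup>+w. ennreal (norm ((cmod (laplace_kernel \<phi> (z + cnj w)))\<^sup>2 * exp (- 2 * \<phi> (Re w)))) \<partial>lborel) < \<infinity>" .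
qed measurable

lemma phi_Re_continuous: "continuous_on S (\<lambda>w. \<phi> (Re w))"
  by (rule continuous_on_compose2[OF continuous]) (auto intro!: continuous_intros)

section \<open>Truncation of the Laplace integral and its tail\<close>

definition truncated_laplace :: "real \<Rightarrow> real \<Rightarrow> real" where
  "truncated_laplace N \<eta> = (LINT r|lborel. indicator {-N..N} r *\<^sub>R exp (2 * (r * \<eta> - \<phi> r)))"

lemma truncated_laplace_measurable [measurable]: "truncated_laplace N \<in> borel_measurable borel"
  unfolding truncated_laplace_def by measurable

lemma truncated_laplace_integrable:
  "integrable lborel (\<lambda>r. indicator {-N..N} r *\<^sub>R exp (2 * (r * \<eta> - \<phi> r)))"
  by (intro integrable_continuous_on_Icc continuous_intros continuous_on_subset[OF continuous]) auto

lemma truncated_laplace_nonneg: "0 \<le> truncated_laplace N \<eta>"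
  unfolding truncated_laplace_def by (intro Bochner_Integration.integral_nonneg) auto

lemma truncated_laplace_le: "truncated_laplace N \<eta> \<le> G \<eta>"
  unfolding truncated_laplace_def laplace_integral_def
  by (intro integral_mono truncated_laplace_integrable integrable_tilt) (auto simp: indicator_def)

lemma truncated_laplace_tendsto: "(\<lambda>n. truncated_laplace (real n) \<eta>) \<longlonglongrightarrow> G \<eta>"
  unfolding truncated_laplace_def laplace_integral_def
proof (rule integral_dominated_convergence)
  show "integrable lborel (\<lambda>r. exp (2 * (r * \<eta> - \<phi> r)))" by (rule integrable_tilt)
  show "AE r in lborel. (\<lambda>n. indicator {- real n..real n} r *\<^sub>R exp (2 * (r * \<eta> - \<phi> r))) \<longlonglongrightarrow> exp (2 * (r * \<eta> - \<phi> r))"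
  proof (rule AE_I2, rule tendsto_eventually)
    fix r :: real
    obtain m where "\<bar>r\<bar> \<le> real m" using real_arch_simple by blast
    then show "\<forall>\<^sub>F n in sequentially. indicator {- real n..real n} r *\<^sub>R exp (2 * (r * \<eta> - \<phi> r)) = exp (2 * (r * \<eta> - \<phi> r))"
      by (intro eventually_sequentiallyI[of m]) (auto simp: indicator_def)
  qed
qed (auto simp: indicator_def)

text \<open>For \<open>|r| <= N\<close> the factor \<open>exp (2 * r * \<eta>)\<close> is at most
  \<open>exp (2 * N * |\<eta>|)\<close>, and what remains integrates to at most \<open>G 0\<close>.
  This dominates the error integral in \<open>box_kernel_estimate\<close>.\<close>

lemma truncated_laplace_growth: "truncated_laplace N \<eta> \<le> exp (2 * N * \<bar>\<eta>\<bar>) * G 0"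
proof -
  have "truncated_laplace N \<eta> \<le> (LINT r|lborel. exp (2 * N * \<bar>\<eta>\<bar>) * exp (2 * (r * 0 - \<phi> r)))"
    unfolding truncated_laplace_def
  proof (rule integral_mono[OF truncated_laplace_integrable])
    show "integrable lborel (\<lambda>r. exp (2 * N * \<bar>\<eta>\<bar>) * exp (2 * (r * 0 - \<phi> r)))"
      by (intro integrable_mult_right integrable_tilt)
    fix r
    show "indicator {-N..N} r *\<^sub>R exp (2 * (r * \<eta> - \<phi> r)) \<le> exp (2 * N * \<bar>\<eta>\<bar>) * exp (2 * (r * 0 - \<phi> r))"
    proof (cases "r \<in> {-N..N}")
      case True
      then have "\<bar>r\<bar> * \<bar>\<eta>\<bar> \<le> N * \<bar>\<eta>\<bar>" by (intro mult_right_mono) auto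
      then have "r * \<eta> \<le> N * \<bar>\<eta>\<bar>" using abs_ge_self[of "r * \<eta>"] by (simp add: abs_mult)
      then show ?thesis using True by (simp add: exp_add[symmetric])
    qed simp
  qed
  also have "\<dots> = exp (2 * N * \<bar>\<eta>\<bar>) * G 0"
    unfolding laplace_integral_def by (rule integral_mult_right_zero)
  finally show ?thesis .
qed

definition tail_ratio :: "real \<Rightarrow> real \<Rightarrow> real" where
  "tail_ratio N \<eta> = 1 - truncated_laplace N \<eta> / G \<eta>"

lemma tail_ratio_measurable [measurable]: "tail_ratio N \<in> borel_measurable borel"
  unfolding tail_ratio_def by measurable

lemma tail_ratio_bounds: "0 \<le> tail_ratio N \<eta>" "tail_ratio N \<eta> \<le> 1"
  using truncated_laplace_le[of N \<eta>] truncated_laplace_nonneg[of N \<eta>] G_pos[of \<eta>]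
  by (auto simp: tail_ratio_def divide_le_eq_1)

text \<open>A squared L2 norm. The exponential bounds \<open>exp (\<eta> * (Re z - u))\<close> on
  the half-line of \<open>\<eta>\<close> where the latter decays, for a line \<open>Re w = u\<close>
  at distance at least \<open>d\<close> from \<open>z\<close>.\<close>

definition tail_L2 :: "real \<Rightarrow> real \<Rightarrow> real" where
  "tail_L2 d N = (LINT \<eta>|lborel. (tail_ratio N \<eta> * exp (- (d * \<bar>\<eta>\<bar>)))\<^sup>2)"

lemma tail_square_bound: "(tail_ratio N \<eta> * exp (- (d * \<bar>\<eta>\<bar>)))\<^sup>2 \<le> exp (- (2 * d * \<bar>\<eta>\<bar>))"
proof -
  have "(tail_ratio N \<eta> * exp (- (d * \<bar>\<eta>\<bar>)))\<^sup>2 \<le> (1 * exp (- (d * \<bar>\<eta>\<bar>)))\<^sup>2"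
    using tail_ratio_bounds by (intro power_mono mult_right_mono) auto
  then show ?thesis by (simp add: exp_double[symmetric] mult.assoc)
qed

lemma tail_square_integrable:
  assumes "0 < d"
  shows "integrable lborel (\<lambda>\<eta>. (tail_ratio N \<eta> * exp (- (d * \<bar>\<eta>\<bar>)))\<^sup>2)"
  by (rule Bochner_Integration.integrable_bound[OF integrable_exp_neg_abs[of "2 * d"]])
     (use assms tail_square_bound in auto)

lemma tail_L2_nonneg: "0 \<le> tail_L2 d N"
  unfolding tail_L2_def by (intro Bochner_Integration.integral_nonneg) auto

text \<open>Dominated convergence: the truncations exhaust \<open>G\<close>, so the tail ratio tends
  to 0 pointwise, under the majorant \<open>exp (- 2 * d * |\<eta>|)\<close>.\<close>

lemma tail_L2_tendsto:
  assumes "0 < d"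
  shows "(\<lambda>n. tail_L2 d (real n)) \<longlonglongrightarrow> 0"
proof -
  have "(\<lambda>n. tail_L2 d (real n)) \<longlonglongrightarrow> (LINT \<eta>|(lborel :: real measure). 0)"
    unfolding tail_L2_def
  proof (rule integral_dominated_convergence)
    show "integrable lborel (\<lambda>\<eta>. exp (- (2 * d * \<bar>\<eta>\<bar>)))"
      using assms by (intro integrable_exp_neg_abs) simp
    show "AE \<eta> in lborel. (\<lambda>n. (tail_ratio (real n) \<eta> * exp (- (d * \<bar>\<eta>\<bar>)))\<^sup>2) \<longlonglongrightarrow> 0"
    proof (rule AE_I2)
      fix \<eta>
      have "(\<lambda>n. ((1 - truncated_laplace (real n) \<eta> / G \<eta>) * exp (- (d * \<bar>\<eta>\<bar>)))\<^sup>2) \<longlonglongrightarrow> ((1 - G \<eta> / G \<eta>) * exp (- (d * \<bar>\<eta>\<bar>)))\<^sup>2"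
        using G_pos[of \<eta>] by (intro tendsto_intros truncated_laplace_tendsto) auto
      then show "(\<lambda>n. (tail_ratio (real n) \<eta> * exp (- (d * \<bar>\<eta>\<bar>)))\<^sup>2) \<longlonglongrightarrow> 0"
        using G_pos[of \<eta>] by (simp add: tail_ratio_def)
    qed
  qed (use tail_square_bound in auto)
  then show ?thesis by simp
qed

end

section \<open>Functions in the weighted space\<close>

lemma norm_integral_le_integral:
  fixes f :: "'a \<Rightarrow> 'b::{banach, second_countable_topology}"
  assumes "integrable M g" "\<And>x. norm (f x) \<le> g x"
  shows "norm (integral\<^sup>L M f) \<le> integral\<^sup>L M g"
proof -
  have "norm (integral\<^sup>L M f) \<le> (LINT x|M. norm (f x))" by (rule integral_norm_bound)
  also have "\<dots> \<le> integral\<^sup>L M g"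
    using assms by (intro integral_mono') (auto intro: order_trans[OF norm_ge_zero])
  finally show ?thesis .
qed

text \<open>Because \<open>Re (\<sigma> v)\<close> is the constant \<open>d > 0\<close>, the double
  integral is dominated by \<open>exp (- d * \<eta>)\<close> times \<open>cmod (h v)\<close>. After
  the exchange \<open>exp_half_line\<close> evaluates the inner integral.\<close>

lemma integral_half_line_laplace:
  fixes h \<sigma> :: "real \<Rightarrow> complex"
  assumes h: "integrable lborel h" and [measurable]: "\<sigma> \<in> borel_measurable borel"
    and \<sigma>: "\<And>v. Re (\<sigma> v) = d" and d: "0 < d"
  shows "integrable lborel (\<lambda>\<eta>. indicator {0<..} \<eta> *\<^sub>R (LINT v|lborel. exp (- (complex_of_real \<eta> * \<sigma> v)) * h v))"
    and "(LINT \<eta>|lborel. indicator {0<..} \<eta> *\<^sub>R (LINT v|lborel. exp (- (complex_of_real \<eta> * \<sigma> v)) * h v))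
       = (LINT v|lborel. h v / \<sigma> v)"
proof -
  have [measurable]: "h \<in> borel_measurable borel" using h by auto
  have int: "integrable (lborel \<Otimes>\<^sub>M lborel) (\<lambda>(\<eta>, v). indicator {0<..} \<eta> *\<^sub>R exp (- (complex_of_real \<eta> * \<sigma> v)) * h v)"
  proof (rule integrable_pair_bound)
    show "integrable lborel (\<lambda>\<eta>. norm (indicator {0<..} \<eta> *\<^sub>R exp (- (complex_of_real \<eta> * complex_of_real d))))"
      using d by (intro integrable_norm exp_half_line(1)) simp
    show "integrable lborel (\<lambda>v. norm (h v))" using h by simp
  qed (auto simp: norm_mult \<sigma>)
  have eq: "indicator {0<..} \<eta> *\<^sub>R (LINT v|lborel. exp (- (complex_of_real \<eta> * \<sigma> v)) * h v) =
     (LINT v|lborel. indicator {0<..} \<eta> *\<^sub>R exp (- (complex_of_real \<eta> * \<sigma> v)) * h v)" for \<eta> :: real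
    by simp
  show "integrable lborel (\<lambda>\<eta>. indicator {0<..} \<eta> *\<^sub>R (LINT v|lborel. exp (- (complex_of_real \<eta> * \<sigma> v)) * h v))"
    unfolding eq by (rule lborel_pair.integrable_fst[OF int])
  have "(LINT \<eta>|lborel. indicator {0<..} \<eta> *\<^sub>R (LINT v|lborel. exp (- (complex_of_real \<eta> * \<sigma> v)) * h v))
     = (LINT v|lborel. LINT \<eta>|lborel. indicator {0<..} \<eta> *\<^sub>R exp (- (complex_of_real \<eta> * \<sigma> v)) * h v)"
    unfolding eq by (rule lborel_pair.Fubini_integral[OF int, symmetric])
  also have "\<dots> = (LINT v|lborel. 1 / \<sigma> v * h v)"
    using \<sigma> d by (simp only: integral_mult_left_zero exp_half_line(2))
  finally show "(LINT \<eta>|lborel. indicator {0<..} \<eta> *\<^sub>R (LINT v|lborel. exp (- (complex_of_real \<eta> * \<sigma> v)) * h v))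
       = (LINT v|lborel. h v / \<sigma> v)" by simp
qed

locale laplace_bergman_function = laplace_weight +
  fixes f :: "complex \<Rightarrow> complex"
  assumes holomorphic: "f holomorphic_on UNIV"
    and weighted_L2: "integrable lborel (\<lambda>w. (cmod (f w))\<^sup>2 * exp (- 2 * \<phi> (Re w)))"
begin

lemma f_continuous: "continuous_on S f"
  using holomorphic holomorphic_on_imp_continuous_on continuous_on_subset by blast

lemma f_measurable [measurable]: "f \<in> borel_measurable borel"
  by (intro borel_measurable_continuous_onI f_continuous)

lemma f_line_continuous [continuous_intros]:
  "continuous_on S g \<Longrightarrow> continuous_on S h \<Longrightarrow> continuous_on S (\<lambda>x. f (Complex (g x) (h x)))"
  by (rule continuous_on_compose2[OF f_continuous[of UNIV]]) (auto intro!: continuous_intros)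

section \<open>Size of f on horizontal edges and on vertical lines\<close>

text \<open>The heights \<open>T\<close> and \<open>- T\<close> are taken together because one
  \<open>T\<close> must make both horizontal edges of a rectangle small.\<close>

definition edge :: "real \<Rightarrow> real \<Rightarrow> real" where
  "edge N T = (LINT s|lborel. indicator {-N..N} s *\<^sub>R (cmod (f (Complex s T)) + cmod (f (Complex s (- T)))))"

lemma edge_integrable:
  "integrable lborel (\<lambda>s. indicator {-N..N} s *\<^sub>R (cmod (f (Complex s T)) + cmod (f (Complex s (- T)))))"
  by (intro integrable_continuous_on_Icc continuous_intros)

lemma edge_nonneg: "0 \<le> edge N T"
  unfolding edge_def by (intro Bochner_Integration.integral_nonneg) auto

text \<open>The left side is the horizontal part of \<open>rectangle_integral\<close>. Passing from
  \<open>{a..b}\<close> to \<open>{-N..N}\<close> makes one bound serve all rectangles of this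
  height inside the strip.\<close>

lemma edge_bound:
  assumes ab: "{a..b} \<subseteq> {-N..N}" and B: "0 \<le> B"
    and g: "\<And>s y. s \<in> {a..b} \<Longrightarrow> \<bar>y\<bar> = \<bar>T\<bar> \<Longrightarrow> cmod (g (Complex s y)) \<le> B * cmod (f (Complex s y))"
  shows "cmod ((LINT s|lborel. indicator {a..b} s *\<^sub>R g (Complex s (- T))) - (LINT s|lborel. indicator {a..b} s *\<^sub>R g (Complex s T))) \<le> B * edge N T"
proof -
  have int: "integrable lborel (\<lambda>s. indicator {-N..N} s *\<^sub>R (B * cmod (f (Complex s y))))" for y
    by (intro integrable_continuous_on_Icc continuous_intros)
  have "cmod (LINT s|lborel. indicator {a..b} s *\<^sub>R g (Complex s y)) \<le> (LINT s|lborel. indicator {-N..N} s *\<^sub>R (B * cmod (f (Complex s y))))"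
    if "\<bar>y\<bar> = \<bar>T\<bar>" for y
    by (rule norm_integral_le_integral[OF int])
       (use ab g that B in \<open>auto simp: indicator_def\<close>)
  from norm_triangle_le_diff[OF add_mono[OF this[of "-T"] this[of T]]]
  have "cmod ((LINT s|lborel. indicator {a..b} s *\<^sub>R g (Complex s (- T))) - (LINT s|lborel. indicator {a..b} s *\<^sub>R g (Complex s T)))
     \<le> (LINT s|lborel. indicator {-N..N} s *\<^sub>R (B * cmod (f (Complex s (-T))))) + (LINT s|lborel. indicator {-N..N} s *\<^sub>R (B * cmod (f (Complex s T))))"
    by simp
  also have "\<dots> = (LINT s|lborel. indicator {-N..N} s *\<^sub>R (B * cmod (f (Complex s (-T)))) + indicator {-N..N} s *\<^sub>R (B * cmod (f (Complex s T))))"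
    by (rule Bochner_Integration.integral_add[OF int int, symmetric])
  also have "\<dots> = (LINT s|lborel. B * (indicator {-N..N} s *\<^sub>R (cmod (f (Complex s T)) + cmod (f (Complex s (- T))))))"
    by (simp add: algebra_simps)
  also have "\<dots> = B * edge N T" unfolding edge_def by (rule integral_mult_right_zero)
  finally show ?thesis .
qed

lemma nn_integral_weighted_L2:
  "(\<integral>\<^sup>+w. ennreal ((cmod (f w))\<^sup>2 * exp (- 2 * \<phi> (Re w))) \<partial>lborel) < \<infinity>"
  using weighted_L2 by (simp add: integrable_iff_bounded)

text \<open>By Tonelli the weighted line integrals have a finite integral over the abscissa, hence
  are finite almost everywhere. The positive weight can be divided out, and an open interval is not
  a null set.\<close>

lemma line_L2:
  assumes "\<alpha> < \<beta>"
  obtains a C where "\<alpha> < a" "a < \<beta>" "0 \<le> C"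
    "(\<integral>\<^sup>+v. ennreal ((cmod (f (Complex a v)))\<^sup>2) \<partial>lborel) \<le> ennreal C"
proof -
  define L where "L u = (\<integral>\<^sup>+v. ennreal ((cmod (f (Complex u v)))\<^sup>2) \<partial>lborel)" for u
  have [measurable]: "L \<in> borel_measurable borel" unfolding L_def by measurable
  have "(\<integral>\<^sup>+w. ennreal ((cmod (f w))\<^sup>2 * exp (- 2 * \<phi> (Re w))) \<partial>lborel)
     = (\<integral>\<^sup>+u. \<integral>\<^sup>+v. ennreal ((cmod (f (Complex u v)))\<^sup>2) * ennreal (exp (- 2 * \<phi> u)) \<partial>lborel \<partial>lborel)"
    by (subst nn_integral_complex) (auto simp: ennreal_mult')
  also have "\<dots> = (\<integral>\<^sup>+u. L u * ennreal (exp (- 2 * \<phi> u)) \<partial>lborel)"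
    unfolding L_def by (intro nn_integral_cong nn_integral_multc) measurable
  finally have "(\<integral>\<^sup>+u. L u * ennreal (exp (- 2 * \<phi> u)) \<partial>lborel) \<noteq> \<infinity>"
    using nn_integral_weighted_L2 by simp
  then have "AE u in lborel. L u * ennreal (exp (- 2 * \<phi> u)) \<noteq> \<infinity>"
    by (rule nn_integral_PInf_AE[rotated]) measurable
  then have AE: "AE u in lborel. L u \<noteq> \<infinity>"
    by eventually_elim (auto simp: ennreal_top_mult)
  have "\<exists>u\<in>{\<alpha><..<\<beta>}. L u \<noteq> \<infinity>"
  proof (rule ccontr)
    assume "\<not> ?thesis"
    with AE have "AE u in lborel. \<not> (\<alpha> < u \<and> u < \<beta>)" by auto
    then have "emeasure lborel {u \<in> space lborel. \<alpha> < u \<and> u < \<beta>} = 0"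
      by (intro emeasure_eq_0_AE)
    also have "{u \<in> space lborel. \<alpha> < u \<and> u < \<beta>} = {\<alpha><..<\<beta>}" by auto
    finally show False using assms by (simp add: ennreal_eq_0_iff)
  qed
  then obtain a where "\<alpha> < a" "a < \<beta>" "L a \<noteq> \<infinity>" by auto
  then show thesis
    using that[of a "enn2real (L a)"] by (simp add: L_def ennreal_enn2real_if)
qed

text \<open>The weight is bounded below on the strip, since \<open>\<phi>\<close> is bounded on
  \<open>{-N..N}\<close>. The outer variable is the height, as needed for the choice of horizontal
  edges.\<close>

lemma strip_L2:
  "(\<integral>\<^sup>+T. \<integral>\<^sup>+s. indicator {-N..N} s * ennreal ((cmod (f (Complex s T)))\<^sup>2) \<partial>lborel \<partial>lborel) < \<infinity>"
proof -
  have "bounded (\<phi> ` {-N..N})"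
    by (intro compact_imp_bounded compact_continuous_image continuous_on_subset[OF continuous]) auto
  then obtain M where M: "\<And>r. r \<in> {-N..N} \<Longrightarrow> \<bar>\<phi> r\<bar> \<le> M"
    unfolding bounded_iff by (metis imageI real_norm_def)
  have "(\<integral>\<^sup>+T. \<integral>\<^sup>+s. indicator {-N..N} s * ennreal ((cmod (f (Complex s T)))\<^sup>2) \<partial>lborel \<partial>lborel)
     = (\<integral>\<^sup>+w. indicator {-N..N} (Re w) * ennreal ((cmod (f w))\<^sup>2) \<partial>lborel)"
    by (subst nn_integral_complex_swapped) auto
  also have "\<dots> \<le> (\<integral>\<^sup>+w. ennreal (exp (2 * M)) * ennreal ((cmod (f w))\<^sup>2 * exp (- 2 * \<phi> (Re w))) \<partial>lborel)"
  proof (rule nn_integral_mono)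
    fix w
    show "indicator {-N..N} (Re w) * ennreal ((cmod (f w))\<^sup>2) \<le> ennreal (exp (2 * M)) * ennreal ((cmod (f w))\<^sup>2 * exp (- 2 * \<phi> (Re w)))"
    proof (cases "Re w \<in> {-N..N}")
      case True
      have "1 \<le> exp (2 * M) * exp (- 2 * \<phi> (Re w))"
        using M[OF True] by (simp add: exp_add[symmetric])
      from mult_left_mono[OF this, of "(cmod (f w))\<^sup>2"] show ?thesis
        using True by (simp add: ennreal_mult'[symmetric] mult_ac)
    qed simp
  qed
  also have "\<dots> = ennreal (exp (2 * M)) * (\<integral>\<^sup>+w. ennreal ((cmod (f w))\<^sup>2 * exp (- 2 * \<phi> (Re w))) \<partial>lborel)"
    by (rule nn_integral_cmult) measurable
  also have "\<dots> < \<infinity>"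
    using nn_integral_weighted_L2 by (simp add: ennreal_mult_less_top)
  finally show ?thesis .
qed

text \<open>If \<open>edge N T >= c\<close> held for all \<open>T > T0\<close>, the squared L2 norms
  over the two edges would add up to at least \<open>\<delta> * c\<close> for all these
  \<open>T\<close>, and their integral over the half-line would contradict
  \<open>strip_L2\<close>.\<close>

lemma small_edge:
  assumes N: "0 < N" and c: "0 < c"
  obtains T where "T0 < T" "edge N T < c"
proof -
  define H where "H T = (\<integral>\<^sup>+s. indicator {-N..N} s * ennreal ((cmod (f (Complex s T)))\<^sup>2) \<partial>lborel)" for T
  have [measurable]: "H \<in> borel_measurable borel" unfolding H_def by measurable
  have H: "(\<integral>\<^sup>+T. H T \<partial>lborel) < \<infinity>" unfolding H_def by (rule strip_L2)
  moreover have "(\<integral>\<^sup>+T. H T \<partial>lborel) = (\<integral>\<^sup>+T. H (- T) \<partial>lborel)"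
    by (subst nn_integral_real_affine[of H "-1" 0]) auto
  ultimately have fin: "(\<integral>\<^sup>+T. H T + H (- T) \<partial>lborel) < \<infinity>"
    by (simp add: nn_integral_add)
  \<comment> \<open>In \<open>x <= \<delta> / 2 + x^2 / (2 * \<delta>)\<close> this choice makes the
    constant terms of the two edges integrate to \<open>2 * N * \<delta> = c / 2\<close>, half of
    the assumed lower bound.\<close>
  define \<delta> where "\<delta> = c / (4 * N)"
  have \<delta>: "0 < \<delta>" using N c by (simp add: \<delta>_def)
  have "\<exists>T>T0. edge N T < c"
  proof (rule ccontr)
    assume "\<not> ?thesis"
    then have large: "c \<le> edge N T" if "T0 < T" for T using that by force
    have "ennreal (\<delta> * c) \<le> H T + H (- T)" if "T0 < T" for T
    proof -
      define q where "q s = (cmod (f (Complex s T)))\<^sup>2 + (cmod (f (Complex s (- T))))\<^sup>2" for s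
      have q: "integrable lborel (\<lambda>s. indicator {-N..N} s *\<^sub>R q s)"
        unfolding q_def by (intro integrable_continuous_on_Icc continuous_intros)
      have i1: "integrable lborel (\<lambda>s. indicator {-N..N} s *\<^sub>R \<delta>)"
        by (intro integrable_continuous_on_Icc continuous_intros)
      have "edge N T \<le> (LINT s|lborel. indicator {-N..N} s *\<^sub>R \<delta> + (indicator {-N..N} s *\<^sub>R q s) / (2 * \<delta>))"
        unfolding edge_def
      proof (rule integral_mono[OF edge_integrable])
        show "integrable lborel (\<lambda>s. indicator {-N..N} s *\<^sub>R \<delta> + (indicator {-N..N} s *\<^sub>R q s) / (2 * \<delta>))"
          using q i1 by simp
        fix s
        have amgm: "x \<le> \<delta> / 2 + x\<^sup>2 / (2 * \<delta>)" for x
        proof -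
          have "2 * \<delta> * x \<le> \<delta>\<^sup>2 + x\<^sup>2" by (rule sum_squares_bound)
          then show ?thesis using \<delta> by (simp add: field_simps power2_eq_square)
        qed
        show "indicator {-N..N} s *\<^sub>R (cmod (f (Complex s T)) + cmod (f (Complex s (- T))))
           \<le> indicator {-N..N} s *\<^sub>R \<delta> + (indicator {-N..N} s *\<^sub>R q s) / (2 * \<delta>)"
          using amgm[of "cmod (f (Complex s T))"] amgm[of "cmod (f (Complex s (- T)))"]
          by (auto simp: indicator_def q_def add_divide_distrib)
      qed
      also have "\<dots> = 2 * N * \<delta> + (LINT s|lborel. indicator {-N..N} s *\<^sub>R q s) / (2 * \<delta>)"
        using q i1 N by (subst Bochner_Integration.integral_add) auto
      finally have "c \<le> 2 * N * \<delta> + (LINT s|lborel. indicator {-N..N} s *\<^sub>R q s) / (2 * \<delta>)"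
        using large[OF that] by simp
      moreover have "2 * N * \<delta> = c / 2" using N by (simp add: \<delta>_def)
      ultimately have "c / 2 \<le> (LINT s|lborel. indicator {-N..N} s *\<^sub>R q s) / (2 * \<delta>)"
        by linarith
      then have "\<delta> * c \<le> (LINT s|lborel. indicator {-N..N} s *\<^sub>R q s)"
        using \<delta> by (simp add: field_simps)
      also have "ennreal (LINT s|lborel. indicator {-N..N} s *\<^sub>R q s) = (\<integral>\<^sup>+s. ennreal (indicator {-N..N} s *\<^sub>R q s) \<partial>lborel)"
        by (rule nn_integral_eq_integral[OF q, symmetric]) (auto simp: q_def)
      also have "\<dots> = (\<integral>\<^sup>+s. indicator {-N..N} s * ennreal ((cmod (f (Complex s T)))\<^sup>2) + indicator {-N..N} s * ennreal ((cmod (f (Complex s (- T))))\<^sup>2) \<partial>lborel)"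
        by (intro nn_integral_cong) (auto simp: indicator_def q_def)
      also have "\<dots> = H T + H (- T)"
        unfolding H_def by (rule nn_integral_add) measurable
      finally show ?thesis by (simp add: ennreal_leI)
    qed
    then have "(\<integral>\<^sup>+T. ennreal (\<delta> * c) * indicator {T0<..} T \<partial>lborel) \<le> (\<integral>\<^sup>+T. H T + H (- T) \<partial>lborel)"
      by (intro nn_integral_mono) (auto simp: indicator_def)
    also have "(\<integral>\<^sup>+T. ennreal (\<delta> * c) * indicator {T0<..} T \<partial>lborel) = ennreal (\<delta> * c) * emeasure lborel {T0<..}"
      by (rule nn_integral_cmult_indicator) auto
    also have "\<dots> = \<infinity>"
    proof -
      have "ennreal (real n) \<le> emeasure lborel {T0<..}" for n
      proof -
        have "ennreal (real n) = emeasure lborel {T0<..<T0 + real n}" by simp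
        also have "\<dots> \<le> emeasure lborel {T0<..}" by (rule emeasure_mono) auto
        finally show ?thesis .
      qed
      then have "emeasure lborel {T0<..} = \<infinity>"
        by (metis ennreal_of_nat_eq_real_of_nat ennreal_Ex_less_of_nat infinity_ennreal_def less_le_not_le top.not_eq_extremum)
      then show ?thesis using \<delta> c by (simp add: ennreal_mult_top)
    qed
    finally show False using fin by simp
  qed
  then show thesis using that by auto
qed

section \<open>Transforms along vertical lines and over boxes\<close>

text \<open>The \<open>A_u\<close> of the introduction. The whole exponential stays in the
  integrand, which is then holomorphic in \<open>w\<close>, so that Cauchy's theorem can move the
  line.\<close>

definition vertical_transform :: "real \<Rightarrow> real \<Rightarrow> real \<Rightarrow> complex" where
  "vertical_transform T u \<eta> = (LINT v|lborel. indicator {-T..T} v *\<^sub>R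
      (exp (- (complex_of_real \<eta> * Complex u v)) * f (Complex u v)))"

lemma vertical_transform_measurable [measurable (raw)]:
  assumes [measurable]: "u \<in> borel_measurable M" "\<eta> \<in> borel_measurable M"
  shows "(\<lambda>x. vertical_transform T (u x) (\<eta> x)) \<in> borel_measurable M"
  unfolding vertical_transform_def by measurable

text \<open>Cauchy's theorem for \<open>exp (- \<eta> * w) * f w\<close> on the rectangle between
  the two lines: the vertical sides differ by the horizontal edges, on which the exponential is at
  most \<open>exp (N * |\<eta>|)\<close>.\<close>

lemma vertical_transform_shift:
  assumes u: "u \<in> {-N..N}" and c: "c \<in> {-N..N}" and T: "0 < T"
  shows "cmod (vertical_transform T u \<eta> - vertical_transform T c \<eta>) \<le> exp (N * \<bar>\<eta>\<bar>) * edge N T"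
proof -
  define g where "g w = exp (- (complex_of_real \<eta> * w)) * f w" for w
  have shift: "cmod (vertical_transform T b \<eta> - vertical_transform T a \<eta>) \<le> exp (N * \<bar>\<eta>\<bar>) * edge N T"
    if "a \<in> {-N..N}" "b \<in> {-N..N}" "a < b" for a b
  proof -
    have "rectangle_integral g a b T = 0"
      using holomorphic that T unfolding g_def
      by (intro rectangle_integral_holomorphic holomorphic_intros) auto
    then have "(LINT s|lborel. indicator {a..b} s *\<^sub>R g (Complex s (- T))) - (LINT s|lborel. indicator {a..b} s *\<^sub>R g (Complex s T))
       = - \<i> * (vertical_transform T b \<eta> - vertical_transform T a \<eta>)"
      unfolding rectangle_integral_def vertical_transform_def g_def[symmetric]
      by (simp add: algebra_simps add_eq_0_iff eq_diff_eq)
    then have "cmod (vertical_transform T b \<eta> - vertical_transform T a \<eta>) =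
       cmod ((LINT s|lborel. indicator {a..b} s *\<^sub>R g (Complex s (- T))) - (LINT s|lborel. indicator {a..b} s *\<^sub>R g (Complex s T)))"
      by (simp only: norm_mult norm_minus_cancel norm_ii mult_1)
    also have "\<dots> \<le> exp (N * \<bar>\<eta>\<bar>) * edge N T"
    proof (rule edge_bound)
      fix s y assume s: "s \<in> {a..b}"
      have "\<bar>s\<bar> \<le> N" using s that by auto
      then have "\<bar>s\<bar> * \<bar>\<eta>\<bar> \<le> N * \<bar>\<eta>\<bar>" by (intro mult_right_mono) auto
      then have "- (\<eta> * s) \<le> N * \<bar>\<eta>\<bar>" using abs_ge_minus_self[of "\<eta> * s"] by (simp add: abs_mult mult.commute)
      then show "cmod (g (Complex s y)) \<le> exp (N * \<bar>\<eta>\<bar>) * cmod (f (Complex s y))"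
        unfolding g_def norm_mult by (intro mult_right_mono) auto
    qed (use that in auto)
    finally show ?thesis .
  qed
  show ?thesis
  proof (cases u c rule: linorder_cases)
    case less
    then show ?thesis using shift[of u c] u c by (simp add: norm_minus_commute)
  next
    case equal
    then show ?thesis by (simp add: edge_nonneg)
  next
    case greater
    then show ?thesis using shift[of c u] u c by simp
  qed
qed

lemma vertical_line_integrable:
  "integrable lborel (\<lambda>v. indicator {-T..T} v *\<^sub>R f (Complex u v))"
  by (intro integrable_continuous_on_Icc continuous_intros)

text \<open>What remains of the reproducing integrand over a box after the factor
  \<open>exp (\<eta> * z) / G \<eta>\<close> has been split off.\<close>

definition box_transform :: "real \<Rightarrow> real \<Rightarrow> real \<Rightarrow> complex" where
  "box_transform N T \<eta> = (LINT w|lborel. indicator (cbox (Complex (-N) (-T)) (Complex N T)) w *\<^sub>R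
      (exp (complex_of_real \<eta> * cnj w) * f w * complex_of_real (exp (- 2 * \<phi> (Re w)))))"

lemma box_integrable:
  fixes g :: "complex \<Rightarrow> complex"
  assumes "continuous_on UNIV g"
  shows "integrable lborel (\<lambda>w. indicator (cbox (Complex (-N) (-T)) (Complex N T)) w *\<^sub>R
      (g w * f w * complex_of_real (exp (- 2 * \<phi> (Re w)))))"
  by (rule borel_integrable_compact[OF compact_cbox])
     (intro continuous_intros continuous_on_subset[OF assms] f_continuous phi_Re_continuous subset_UNIV)

text \<open>On the line \<open>Re w = u\<close> one has \<open>cnj w = 2 * u - w\<close>. The
  antiholomorphic exponential thus becomes the holomorphic \<open>exp (- \<eta> * w)\<close> times a
  factor depending on \<open>u\<close> and \<open>\<eta>\<close> only, which merges with the
  weight.\<close>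

lemma box_transform_eq:
  "box_transform N T \<eta> = (LINT u|lborel. (indicator {-N..N} u *\<^sub>R exp (2 * (u * \<eta> - \<phi> u))) *\<^sub>R vertical_transform T u \<eta>)"
proof -
  have "box_transform N T \<eta> = (LINT u|lborel. LINT v|lborel. indicator (cbox (Complex (-N) (-T)) (Complex N T)) (Complex u v) *\<^sub>R
      (exp (complex_of_real \<eta> * cnj (Complex u v)) * f (Complex u v) * complex_of_real (exp (- 2 * \<phi> (Re (Complex u v))))))"
    unfolding box_transform_def by (rule integral_complex, rule box_integrable) (intro continuous_intros)
  also have "\<dots> = (LINT u|lborel. (indicator {-N..N} u *\<^sub>R exp (2 * (u * \<eta> - \<phi> u))) *\<^sub>R vertical_transform T u \<eta>)"
  proof (intro Bochner_Integration.integral_cong refl)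
    fix u :: real
    have e: "exp (complex_of_real \<eta> * cnj (Complex u v)) * complex_of_real (exp (- 2 * \<phi> u)) =
        complex_of_real (exp (2 * (u * \<eta> - \<phi> u))) * exp (- (complex_of_real \<eta> * Complex u v))" for v
      by (simp add: exp_of_real[symmetric] exp_add[symmetric] Complex_eq algebra_simps)
    have "(LINT v|lborel. indicator (cbox (Complex (-N) (-T)) (Complex N T)) (Complex u v) *\<^sub>R
      (exp (complex_of_real \<eta> * cnj (Complex u v)) * f (Complex u v) * complex_of_real (exp (- 2 * \<phi> (Re (Complex u v))))))
      = (LINT v|lborel. (indicator {-N..N} u *\<^sub>R exp (2 * (u * \<eta> - \<phi> u))) *\<^sub>R (indicator {-T..T} v *\<^sub>R
      (exp (- (complex_of_real \<eta> * Complex u v)) * f (Complex u v))))"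
      unfolding indicator_cbox_Complex
    proof (intro Bochner_Integration.integral_cong refl)
      fix v
      show "(indicator {-N..N} u * indicator {-T..T} v :: real) *\<^sub>R (exp (complex_of_real \<eta> * cnj (Complex u v)) * f (Complex u v) * complex_of_real (exp (- 2 * \<phi> (Re (Complex u v)))))
        = (indicator {-N..N} u *\<^sub>R exp (2 * (u * \<eta> - \<phi> u))) *\<^sub>R (indicator {-T..T} v *\<^sub>R
      (exp (- (complex_of_real \<eta> * Complex u v)) * f (Complex u v)))"
        using e[of v] by (simp add: indicator_def scaleR_conv_of_real mult_ac)
    qed
    then show "(LINT v|lborel. indicator (cbox (Complex (-N) (-T)) (Complex N T)) (Complex u v) *\<^sub>R
      (exp (complex_of_real \<eta> * cnj (Complex u v)) * f (Complex u v) * complex_of_real (exp (- 2 * \<phi> (Re (Complex u v))))))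
      = (indicator {-N..N} u *\<^sub>R exp (2 * (u * \<eta> - \<phi> u))) *\<^sub>R vertical_transform T u \<eta>"
      unfolding vertical_transform_def by (simp only: integral_scaleR_right)
  qed
  finally show ?thesis .
qed

text \<open>The box transform is a superposition of the \<open>A_u\<close> with a weight of total
  mass \<open>truncated_laplace N \<eta>\<close>; replacing every \<open>A_u\<close> by
  \<open>A_c\<close> costs at most the shift error times this mass.\<close>

lemma box_transform_approx:
  assumes c: "c \<in> {-N..N}" and T: "0 < T"
  shows "cmod (box_transform N T \<eta> - truncated_laplace N \<eta> *\<^sub>R vertical_transform T c \<eta>)
    \<le> truncated_laplace N \<eta> * (exp (N * \<bar>\<eta>\<bar>) * edge N T)"
proof -
  define \<rho> where "\<rho> u = indicator {-N..N} u *\<^sub>R exp (2 * (u * \<eta> - \<phi> u))" for u :: real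
  have \<rho>: "integrable lborel \<rho>" unfolding \<rho>_def by (rule truncated_laplace_integrable)
  have [measurable]: "\<rho> \<in> borel_measurable borel" using \<rho> by auto
  have bound: "norm (\<rho> u *\<^sub>R (vertical_transform T u \<eta> - vertical_transform T c \<eta>)) \<le> \<rho> u * (exp (N * \<bar>\<eta>\<bar>) * edge N T)" for u
    using vertical_transform_shift[OF _ c T, of u \<eta>] by (auto simp: \<rho>_def indicator_def)
  have i: "integrable lborel (\<lambda>u. \<rho> u * (exp (N * \<bar>\<eta>\<bar>) * edge N T))" using \<rho> by simp
  have d: "integrable lborel (\<lambda>u. \<rho> u *\<^sub>R (vertical_transform T u \<eta> - vertical_transform T c \<eta>))"
    by (rule Bochner_Integration.integrable_bound[OF i])
       (use bound in \<open>auto intro!: AE_I2 order_trans[OF _ abs_ge_self]\<close>)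
  have k: "integrable lborel (\<lambda>u. \<rho> u *\<^sub>R vertical_transform T c \<eta>)" using \<rho> by simp
  have "box_transform N T \<eta> = (LINT u|lborel. \<rho> u *\<^sub>R (vertical_transform T u \<eta> - vertical_transform T c \<eta>) + \<rho> u *\<^sub>R vertical_transform T c \<eta>)"
    unfolding box_transform_eq \<rho>_def by (simp add: scaleR_diff_right)
  also have "\<dots> = (LINT u|lborel. \<rho> u *\<^sub>R (vertical_transform T u \<eta> - vertical_transform T c \<eta>)) + truncated_laplace N \<eta> *\<^sub>R vertical_transform T c \<eta>"
    unfolding Bochner_Integration.integral_add[OF d k] truncated_laplace_def \<rho>_def[symmetric]
    by (subst integral_scaleR_left) (auto intro: \<rho>)
  finally have "cmod (box_transform N T \<eta> - truncated_laplace N \<eta> *\<^sub>R vertical_transform T c \<eta>)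
     = cmod (LINT u|lborel. \<rho> u *\<^sub>R (vertical_transform T u \<eta> - vertical_transform T c \<eta>))" by simp
  also have "\<dots> \<le> (LINT u|lborel. \<rho> u * (exp (N * \<bar>\<eta>\<bar>) * edge N T))"
    by (rule norm_integral_le_integral[OF i bound])
  also have "\<dots> = truncated_laplace N \<eta> * (exp (N * \<bar>\<eta>\<bar>) * edge N T)"
    by (simp add: truncated_laplace_def \<rho>_def)
  finally show ?thesis .
qed

text \<open>Fubini for the \<open>\<eta>\<close> integral inside the kernel and the integral over
  the box. There \<open>|Re w| <= |N|\<close>, so
  \<open>exp ((|Re z| + |N|) * |\<eta>|) / G \<eta>\<close> times the weighted modulus of
  \<open>f\<close> is a majorant.\<close>

lemma box_kernel_integral:
  shows "integrable lborel (\<lambda>\<eta>. exp (complex_of_real \<eta> * z) / complex_of_real (G \<eta>) * box_transform N T \<eta>)"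
    and "(LINT w|lborel. indicator (cbox (Complex (-N) (-T)) (Complex N T)) w *\<^sub>R
        (laplace_kernel \<phi> (z + cnj w) * f w * complex_of_real (exp (- 2 * \<phi> (Re w)))))
     = complex_of_real (1 / (2 * pi)) *
       (LINT \<eta>|lborel. exp (complex_of_real \<eta> * z) / complex_of_real (G \<eta>) * box_transform N T \<eta>)"
proof -
  define R where "R = cbox (Complex (-N) (-T)) (Complex N T)"
  define h where "h w = indicator R w *\<^sub>R (f w * complex_of_real (exp (- 2 * \<phi> (Re w))))" for w
  have "integrable lborel (\<lambda>w. indicator R w *\<^sub>R (1 * f w * complex_of_real (exp (- 2 * \<phi> (Re w)))))"
    unfolding R_def by (rule box_integrable) (rule continuous_on_const)
  then have h: "integrable lborel h" by (simp add: h_def[abs_def])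
  have [measurable]: "h \<in> borel_measurable borel" using h by auto
  have int: "integrable (lborel \<Otimes>\<^sub>M lborel) (\<lambda>(\<eta>, w). exp (complex_of_real \<eta> * (z + cnj w)) / complex_of_real (G \<eta>) * h w)"
  proof (rule integrable_pair_bound)
    show "integrable lborel (\<lambda>\<eta>. exp ((\<bar>Re z\<bar> + \<bar>N\<bar>) * \<bar>\<eta>\<bar>) / G \<eta>)" by (rule integrable_exp_abs_div_G)
    show "integrable lborel (\<lambda>w. norm (h w))" using h by simp
    fix \<eta> :: real and w :: complex
    show "norm (case (\<eta>, w) of (\<eta>, w) \<Rightarrow> exp (complex_of_real \<eta> * (z + cnj w)) / complex_of_real (G \<eta>) * h w)
      \<le> exp ((\<bar>Re z\<bar> + \<bar>N\<bar>) * \<bar>\<eta>\<bar>) / G \<eta> * norm (h w)"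
    proof (cases "w \<in> R")
      case True
      then have "\<bar>Re w\<bar> \<le> \<bar>N\<bar>" by (auto simp: R_def in_cbox_complex_iff)
      then have "\<bar>\<eta>\<bar> * \<bar>Re z + Re w\<bar> \<le> \<bar>\<eta>\<bar> * (\<bar>Re z\<bar> + \<bar>N\<bar>)" by (intro mult_left_mono) auto
      then have "\<eta> * (Re z + Re w) \<le> (\<bar>Re z\<bar> + \<bar>N\<bar>) * \<bar>\<eta>\<bar>"
        using abs_ge_self[of "\<eta> * (Re z + Re w)"] by (simp add: abs_mult mult.commute)
      then show ?thesis
        using G_pos[of \<eta>] by (auto simp: norm_mult norm_divide intro!: mult_right_mono divide_right_mono)
    qed (simp add: h_def)
  qed measurable
  have J: "(LINT w|lborel. exp (complex_of_real \<eta> * (z + cnj w)) / complex_of_real (G \<eta>) * h w) =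
      exp (complex_of_real \<eta> * z) / complex_of_real (G \<eta>) * box_transform N T \<eta>" for \<eta>
  proof -
    have "exp (complex_of_real \<eta> * (z + cnj w)) / complex_of_real (G \<eta>) * h w =
      exp (complex_of_real \<eta> * z) / complex_of_real (G \<eta>) *
      (indicator R w *\<^sub>R (exp (complex_of_real \<eta> * cnj w) * f w * complex_of_real (exp (- 2 * \<phi> (Re w)))))" for w
      by (simp add: h_def distrib_left exp_add)
    then show ?thesis unfolding box_transform_def R_def[symmetric] by (simp only: integral_mult_right_zero)
  qed
  show "integrable lborel (\<lambda>\<eta>. exp (complex_of_real \<eta> * z) / complex_of_real (G \<eta>) * box_transform N T \<eta>)"
    using lborel_pair.integrable_fst[OF int] by (simp only: J)
  have "(LINT w|lborel. indicator R w *\<^sub>R (laplace_kernel \<phi> (z + cnj w) * f w * complex_of_real (exp (- 2 * \<phi> (Re w)))))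
     = (LINT w|lborel. complex_of_real (1 / (2 * pi)) * (LINT \<eta>|lborel. exp (complex_of_real \<eta> * (z + cnj w)) / complex_of_real (G \<eta>) * h w))"
  proof (intro Bochner_Integration.integral_cong refl)
    fix w
    have "indicator R w *\<^sub>R (laplace_kernel \<phi> (z + cnj w) * f w * complex_of_real (exp (- 2 * \<phi> (Re w)))) = laplace_kernel \<phi> (z + cnj w) * h w"
      by (simp add: h_def)
    then show "indicator R w *\<^sub>R (laplace_kernel \<phi> (z + cnj w) * f w * complex_of_real (exp (- 2 * \<phi> (Re w)))) =
       complex_of_real (1 / (2 * pi)) * (LINT \<eta>|lborel. exp (complex_of_real \<eta> * (z + cnj w)) / complex_of_real (G \<eta>) * h w)"
      unfolding laplace_kernel_def by (simp only: integral_mult_left_zero mult.assoc)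
  qed
  also have "\<dots> = complex_of_real (1 / (2 * pi)) * (LINT \<eta>|lborel. LINT w|lborel. exp (complex_of_real \<eta> * (z + cnj w)) / complex_of_real (G \<eta>) * h w)"
    by (simp only: integral_mult_right_zero lborel_pair.Fubini_integral[OF int])
  finally show "(LINT w|lborel. indicator (cbox (Complex (-N) (-T)) (Complex N T)) w *\<^sub>R
        (laplace_kernel \<phi> (z + cnj w) * f w * complex_of_real (exp (- 2 * \<phi> (Re w)))))
     = complex_of_real (1 / (2 * pi)) *
       (LINT \<eta>|lborel. exp (complex_of_real \<eta> * z) / complex_of_real (G \<eta>) * box_transform N T \<eta>)"
    unfolding J R_def .
qed

section \<open>Approximation of the reproducing integral\<close>

text \<open>A vertical side of Cauchy's formula without the factor \<open>\<i>\<close> of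
  \<open>dw\<close>; the value at the pole therefore appears as \<open>2 * pi * f z\<close>.\<close>

definition line_cauchy :: "real \<Rightarrow> complex \<Rightarrow> real \<Rightarrow> complex" where
  "line_cauchy T z u = (LINT v|lborel. indicator {-T..T} v *\<^sub>R (f (Complex u v) / (Complex u v - z)))"

text \<open>To the right of \<open>z\<close>, \<open>1 / (w - z)\<close> is the integral of
  \<open>exp (- \<eta> * (w - z))\<close> over positive \<open>\<eta>\<close>.\<close>

lemma vertical_transform_right:
  assumes "Re z < u"
  shows "integrable lborel (\<lambda>\<eta>. indicator {0<..} \<eta> *\<^sub>R (exp (complex_of_real \<eta> * z) * vertical_transform T u \<eta>))"
    and "(LINT \<eta>|lborel. indicator {0<..} \<eta> *\<^sub>R (exp (complex_of_real \<eta> * z) * vertical_transform T u \<eta>)) = line_cauchy T z u"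
proof -
  have eq: "exp (complex_of_real \<eta> * z) * vertical_transform T u \<eta> =
      (LINT v|lborel. exp (- (complex_of_real \<eta> * (Complex u v - z))) * (indicator {-T..T} v *\<^sub>R f (Complex u v)))" for \<eta>
  proof -
    have "exp (- (complex_of_real \<eta> * (Complex u v - z))) * (indicator {-T..T} v *\<^sub>R f (Complex u v)) =
      exp (complex_of_real \<eta> * z) * (indicator {-T..T} v *\<^sub>R (exp (- (complex_of_real \<eta> * Complex u v)) * f (Complex u v)))" for v
      by (simp add: right_diff_distrib exp_diff exp_minus divide_inverse)
    then show ?thesis unfolding vertical_transform_def by (simp only: integral_mult_right_zero)
  qed
  have "(\<lambda>v. Complex u v - z) \<in> borel_measurable borel" by measurable
  from integral_half_line_laplace[OF vertical_line_integrable[of T u] this, of "u - Re z"] assms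
  show "integrable lborel (\<lambda>\<eta>. indicator {0<..} \<eta> *\<^sub>R (exp (complex_of_real \<eta> * z) * vertical_transform T u \<eta>))"
    and "(LINT \<eta>|lborel. indicator {0<..} \<eta> *\<^sub>R (exp (complex_of_real \<eta> * z) * vertical_transform T u \<eta>)) = line_cauchy T z u"
    unfolding eq line_cauchy_def by (simp_all add: scaleR_conv_of_real)
qed

text \<open>The mirror image: to the left of \<open>z\<close>, reflecting \<open>\<eta>\<close>
  leads to \<open>1 / (z - w)\<close>, whence the minus sign. The half-line is closed so that
  together with \<open>{0<..}\<close> it covers the real line.\<close>

lemma vertical_transform_left:
  assumes "u < Re z"
  shows "integrable lborel (\<lambda>\<eta>. indicator {..0} \<eta> *\<^sub>R (exp (complex_of_real \<eta> * z) * vertical_transform T u \<eta>))"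
    and "(LINT \<eta>|lborel. indicator {..0} \<eta> *\<^sub>R (exp (complex_of_real \<eta> * z) * vertical_transform T u \<eta>)) = - line_cauchy T z u"
proof -
  define g where "g \<eta> = indicator {..0} \<eta> *\<^sub>R (exp (complex_of_real \<eta> * z) * vertical_transform T u \<eta>)" for \<eta> :: real
  define h where "h \<eta> = indicator {0<..} \<eta> *\<^sub>R (exp (complex_of_real (- \<eta>) * z) * vertical_transform T u (- \<eta>))" for \<eta> :: real
  have [measurable]: "g \<in> borel_measurable borel" "h \<in> borel_measurable borel"
    unfolding g_def h_def by measurable
  \<comment> \<open>Reflecting \<open>{..0}\<close> gives a closed half-line, so the two functions
    may differ at 0.\<close>
  have ae: "AE \<eta> in lborel. g (0 + - 1 * \<eta>) = h \<eta>"
    using AE_lborel_singleton[of "0::real"] by eventually_elim (auto simp: g_def h_def indicator_def)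
  have eq: "exp (complex_of_real (- \<eta>) * z) * vertical_transform T u (- \<eta>) =
      (LINT v|lborel. exp (- (complex_of_real \<eta> * (z - Complex u v))) * (indicator {-T..T} v *\<^sub>R f (Complex u v)))" for \<eta>
  proof -
    have "exp (- (complex_of_real \<eta> * (z - Complex u v))) * (indicator {-T..T} v *\<^sub>R f (Complex u v)) =
      exp (complex_of_real (- \<eta>) * z) * (indicator {-T..T} v *\<^sub>R (exp (- (complex_of_real (- \<eta>) * Complex u v)) * f (Complex u v)))" for v
      by (simp add: right_diff_distrib exp_diff exp_minus divide_inverse)
    then show ?thesis unfolding vertical_transform_def by (simp only: integral_mult_right_zero)
  qed
  have "(\<lambda>v. z - Complex u v) \<in> borel_measurable borel" by measurable
  note half = integral_half_line_laplace[OF vertical_line_integrable[of T u] this, of "Re z - u"]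
  have h: "integrable lborel h" "(LINT \<eta>|lborel. h \<eta>) = (LINT v|lborel. (indicator {-T..T} v *\<^sub>R f (Complex u v)) / (z - Complex u v))"
    using half assms unfolding eq h_def by simp_all
  have "integrable lborel (\<lambda>\<eta>. g (0 + - 1 * \<eta>))"
    using h(1) by (subst integrable_cong_AE[OF _ _ ae]) auto
  then show "integrable lborel (\<lambda>\<eta>. indicator {..0} \<eta> *\<^sub>R (exp (complex_of_real \<eta> * z) * vertical_transform T u \<eta>))"
    unfolding g_def[symmetric] by (subst (asm) lborel_integrable_real_affine_iff) auto
  have "(LINT \<eta>|lborel. g \<eta>) = (LINT \<eta>|lborel. g (0 + - 1 * \<eta>))"
    by (subst lborel_integral_real_affine[of "-1" g 0]) auto
  also have "\<dots> = (LINT \<eta>|lborel. h \<eta>)" by (rule integral_cong_AE[OF _ _ ae]) auto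
  also have "\<dots> = (LINT v|lborel. - (indicator {-T..T} v *\<^sub>R (f (Complex u v) / (Complex u v - z))))"
    unfolding h(2)
  proof (intro Bochner_Integration.integral_cong refl)
    fix v
    have "x / (z - Complex u v) = - (x / (Complex u v - z))" for x
      by (metis minus_diff_eq minus_divide_right)
    then show "(indicator {-T..T} v *\<^sub>R f (Complex u v)) / (z - Complex u v) = - (indicator {-T..T} v *\<^sub>R (f (Complex u v) / (Complex u v - z)))"
      by (simp add: scaleR_conv_of_real)
  qed
  finally show "(LINT \<eta>|lborel. indicator {..0} \<eta> *\<^sub>R (exp (complex_of_real \<eta> * z) * vertical_transform T u \<eta>)) = - line_cauchy T z u"
    unfolding g_def line_cauchy_def by simp
qed

text \<open>Cauchy's formula on the rectangle. The condition on \<open>T\<close> keeps the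
  horizontal edges at distance at least 1 from \<open>z\<close>, so \<open>1 / cmod (w - z)\<close>
  is at most 1 on them.\<close>

lemma line_cauchy_difference:
  assumes ab: "a < Re z" "Re z < b" "{a..b} \<subseteq> {-N..N}" and T: "\<bar>Im z\<bar> + 1 < T"
  shows "cmod (line_cauchy T z b - line_cauchy T z a - 2 * pi * f z) \<le> edge N T"
proof -
  define g where "g w = f w / (w - z)" for w
  have "rectangle_integral g a b T = 2 * pi * \<i> * f z"
    unfolding g_def using ab T by (intro rectangle_integral_Cauchy_formula holomorphic) auto
  then have "(LINT s|lborel. indicator {a..b} s *\<^sub>R g (Complex s (- T))) - (LINT s|lborel. indicator {a..b} s *\<^sub>R g (Complex s T))
     = - \<i> * (line_cauchy T z b - line_cauchy T z a - 2 * pi * f z)"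
    unfolding rectangle_integral_def line_cauchy_def g_def[symmetric] by (simp add: algebra_simps)
  then have "cmod (line_cauchy T z b - line_cauchy T z a - 2 * pi * f z) =
     cmod ((LINT s|lborel. indicator {a..b} s *\<^sub>R g (Complex s (- T))) - (LINT s|lborel. indicator {a..b} s *\<^sub>R g (Complex s T)))"
    by (simp only: norm_mult norm_minus_cancel norm_ii mult_1)
  also have "\<dots> \<le> 1 * edge N T"
  proof (rule edge_bound[OF ab(3)])
    fix s y :: real assume y: "\<bar>y\<bar> = \<bar>T\<bar>"
    have "1 \<le> \<bar>Im (Complex s y - z)\<bar>" using T y by (auto simp: abs_if split: if_splits)
    also have "\<dots> \<le> cmod (Complex s y - z)" by (rule abs_Im_le_cmod)
    finally have "cmod (f (Complex s y)) / cmod (Complex s y - z) \<le> cmod (f (Complex s y)) / 1"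
      by (intro divide_left_mono) auto
    then show "cmod (g (Complex s y)) \<le> 1 * cmod (f (Complex s y))"
      by (simp add: g_def norm_divide)
  qed simp
  finally show ?thesis by simp
qed

lemma vertical_transform_fourier:
  "vertical_transform T u \<eta> = exp (- (complex_of_real \<eta> * complex_of_real u)) *
     (LINT v|lborel. (indicator {-T..T} v *\<^sub>R f (Complex u v)) * iexp (- (v * \<eta>)))"
proof -
  have "indicator {-T..T} v *\<^sub>R (exp (- (complex_of_real \<eta> * Complex u v)) * f (Complex u v)) =
    exp (- (complex_of_real \<eta> * complex_of_real u)) * ((indicator {-T..T} v *\<^sub>R f (Complex u v)) * iexp (- (v * \<eta>)))" for v
  proof -
    have "exp (- (complex_of_real \<eta> * Complex u v)) = exp (- (complex_of_real \<eta> * complex_of_real u)) * iexp (- (v * \<eta>))"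
      by (simp add: exp_add[symmetric] Complex_eq algebra_simps)
    then show ?thesis by simp
  qed
  then show ?thesis unfolding vertical_transform_def by (simp only: integral_mult_right_zero)
qed

text \<open>Plancherel's inequality with a bound that does not depend on \<open>T\<close>; this lets
  \<open>T\<close> tend to infinity before \<open>N\<close> does.\<close>

lemma vertical_fourier_L2:
  assumes "(\<integral>\<^sup>+v. ennreal ((cmod (f (Complex u v)))\<^sup>2) \<partial>lborel) \<le> ennreal C"
  shows "(\<integral>\<^sup>+\<eta>. ennreal ((cmod (LINT v|lborel. (indicator {-T..T} v *\<^sub>R f (Complex u v)) * iexp (- (v * \<eta>))))\<^sup>2) \<partial>lborel)
     \<le> ennreal (2 * pi * C)"
proof -
  have "(\<integral>\<^sup>+\<eta>. ennreal ((cmod (LINT v|lborel. (indicator {-T..T} v *\<^sub>R f (Complex u v)) * iexp (- (v * \<eta>))))\<^sup>2) \<partial>lborel)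
     \<le> ennreal (2 * pi) * (\<integral>\<^sup>+v. ennreal ((cmod (indicator {-T..T} v *\<^sub>R f (Complex u v)))\<^sup>2) \<partial>lborel)"
    by (rule fourier_L2_bound[OF vertical_line_integrable])
  also have "\<dots> \<le> ennreal (2 * pi) * (\<integral>\<^sup>+v. ennreal ((cmod (f (Complex u v)))\<^sup>2) \<partial>lborel)"
    by (intro mult_left_mono nn_integral_mono ennreal_leI) (auto simp: indicator_def)
  also have "\<dots> \<le> ennreal (2 * pi) * ennreal C"
    by (intro mult_left_mono assms) auto
  finally show ?thesis by (simp add: ennreal_mult')
qed

text \<open>Cauchy-Schwarz pairs the tail ratio times \<open>exp (\<eta> * (z - u))\<close> with the
  Fourier transform of \<open>f\<close> on the truncated line. By the hypothesis on \<open>S\<close>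
  this exponential decays there at rate \<open>d\<close>, so \<open>tail_L2\<close> controls the
  first factor.\<close>

lemma tail_bound:
  assumes [measurable]: "S \<in> sets borel" and S: "\<And>\<eta>. \<eta> \<in> S \<Longrightarrow> \<eta> * (Re z - u) \<le> - (d * \<bar>\<eta>\<bar>)"
    and C: "(\<integral>\<^sup>+v. ennreal ((cmod (f (Complex u v)))\<^sup>2) \<partial>lborel) \<le> ennreal C" "0 \<le> C" and d: "0 < d"
  shows "cmod (LINT \<eta>|lborel. tail_ratio N \<eta> *\<^sub>R (indicator S \<eta> *\<^sub>R (exp (complex_of_real \<eta> * z) * vertical_transform T u \<eta>)))
    \<le> sqrt (tail_L2 d N * (2 * pi * C))"
proof -
  define q where "q \<eta> = indicator S \<eta> *\<^sub>R (tail_ratio N \<eta> *\<^sub>R exp (complex_of_real \<eta> * (z - complex_of_real u)))" for \<eta>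
  define h where "h \<eta> = (LINT v|lborel. (indicator {-T..T} v *\<^sub>R f (Complex u v)) * iexp (- (v * \<eta>)))" for \<eta>
  have [measurable]: "q \<in> borel_measurable borel" "h \<in> borel_measurable borel"
    unfolding q_def h_def by measurable
  have "tail_ratio N \<eta> *\<^sub>R (indicator S \<eta> *\<^sub>R (exp (complex_of_real \<eta> * z) * vertical_transform T u \<eta>)) = q \<eta> * h \<eta>" for \<eta>
  proof -
    have "exp (complex_of_real \<eta> * (z - complex_of_real u)) = exp (complex_of_real \<eta> * z) * exp (- (complex_of_real \<eta> * complex_of_real u))"
      by (simp add: exp_add[symmetric] algebra_simps)
    then show ?thesis
      unfolding vertical_transform_fourier h_def[symmetric] q_def by (simp add: scaleR_conv_of_real mult_ac)
  qed
  moreover have "cmod (LINT \<eta>|lborel. q \<eta> * h \<eta>) \<le> sqrt (tail_L2 d N * (2 * pi * C))"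
  proof (rule norm_integral_mult_le_L2)
    have "(\<integral>\<^sup>+\<eta>. ennreal ((cmod (q \<eta>))\<^sup>2) \<partial>lborel) \<le> (\<integral>\<^sup>+\<eta>. ennreal ((tail_ratio N \<eta> * exp (- (d * \<bar>\<eta>\<bar>)))\<^sup>2) \<partial>lborel)"
      using S tail_ratio_bounds(1)
      by (intro nn_integral_mono ennreal_leI power_mono)
         (auto simp: q_def indicator_def intro!: mult_left_mono)
    also have "\<dots> = ennreal (tail_L2 d N)"
      unfolding tail_L2_def by (intro nn_integral_eq_integral tail_square_integrable d) auto
    finally show "(\<integral>\<^sup>+\<eta>. ennreal ((cmod (q \<eta>))\<^sup>2) \<partial>lborel) \<le> ennreal (tail_L2 d N)" .
    show "(\<integral>\<^sup>+\<eta>. ennreal ((cmod (h \<eta>))\<^sup>2) \<partial>lborel) \<le> ennreal (2 * pi * C)"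
      unfolding h_def by (rule vertical_fourier_L2[OF C(1)])
  qed (use C(2) tail_L2_nonneg in auto)
  ultimately show ?thesis by simp
qed

text \<open>Three errors add up: \<open>S - P\<close> from moving the lines to \<open>a\<close> and
  \<open>b\<close>, \<open>P\<close> minus the integral of \<open>E\<close> from replacing the ratio
  of truncated to full Laplace integral by 1, and the horizontal edges missing from Cauchy's
  formula.\<close>

lemma box_kernel_estimate:
  assumes ab: "a < Re z" "Re z < b" "{a..b} \<subseteq> {-N..N}" and T: "\<bar>Im z\<bar> + 1 < T"
    and A: "(\<integral>\<^sup>+v. ennreal ((cmod (f (Complex a v)))\<^sup>2) \<partial>lborel) \<le> ennreal A" "0 \<le> A"
    and B: "(\<integral>\<^sup>+v. ennreal ((cmod (f (Complex b v)))\<^sup>2) \<partial>lborel) \<le> ennreal B" "0 \<le> B"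
    and d: "0 < d" "d \<le> b - Re z" "d \<le> Re z - a"
  shows "cmod ((LINT \<eta>|lborel. exp (complex_of_real \<eta> * z) / complex_of_real (G \<eta>) * box_transform N T \<eta>) - 2 * pi * f z)
    \<le> (LINT \<eta>|lborel. exp (\<bar>Re z\<bar> * \<bar>\<eta>\<bar>) / G \<eta> * (truncated_laplace N \<eta> * exp (N * \<bar>\<eta>\<bar>))) * edge N T
      + (sqrt (tail_L2 d N * (2 * pi * B)) + sqrt (tail_L2 d N * (2 * pi * A))) + edge N T"
proof -
  \<comment> \<open>For each sign of \<open>\<eta>\<close> the line lies on the side of
    \<open>z\<close> for which \<open>exp (\<eta> * (z - w))\<close> decays as
    \<open>|\<eta>|\<close> grows.\<close>
  define c where "c \<eta> = (if 0 < \<eta> then b else a)" for \<eta> :: real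
  define E where "E \<eta> = exp (complex_of_real \<eta> * z) * vertical_transform T (c \<eta>) \<eta>" for \<eta>
  define S where "S = (LINT \<eta>|lborel. exp (complex_of_real \<eta> * z) / complex_of_real (G \<eta>) * box_transform N T \<eta>)"
  define Eb where "Eb \<eta> = indicator {0<..} \<eta> *\<^sub>R (exp (complex_of_real \<eta> * z) * vertical_transform T b \<eta>)" for \<eta> :: real
  define Ea where "Ea \<eta> = indicator {..0} \<eta> *\<^sub>R (exp (complex_of_real \<eta> * z) * vertical_transform T a \<eta>)" for \<eta> :: real
  have E_eq: "E \<eta> = Eb \<eta> + Ea \<eta>" for \<eta>
    by (auto simp: E_def Ea_def Eb_def c_def indicator_def)
  have Eb: "integrable lborel Eb" "integral\<^sup>L lborel Eb = line_cauchy T z b"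
    unfolding Eb_def using vertical_transform_right[OF ab(2)] by auto
  have Ea: "integrable lborel Ea" "integral\<^sup>L lborel Ea = - line_cauchy T z a"
    unfolding Ea_def using vertical_transform_left[OF ab(1)] by auto
  have [measurable]: "Ea \<in> borel_measurable borel" "Eb \<in> borel_measurable borel"
    using Ea(1) Eb(1) by auto
  have tail_int: "integrable lborel (\<lambda>\<eta>. tail_ratio N \<eta> *\<^sub>R e \<eta>)" if "integrable lborel e" for e :: "real \<Rightarrow> complex"
    by (rule Bochner_Integration.integrable_bound[OF that])
       (use that tail_ratio_bounds in \<open>auto intro!: AE_I2 mult_left_le_one_le\<close>)
  have E: "integrable lborel E" "integral\<^sup>L lborel E = line_cauchy T z b - line_cauchy T z a"
    unfolding E_eq using Ea Eb by auto
  have P: "integrable lborel (\<lambda>\<eta>. (truncated_laplace N \<eta> / G \<eta>) *\<^sub>R E \<eta>)"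
    and P_eq: "(LINT \<eta>|lborel. E \<eta>) - (LINT \<eta>|lborel. (truncated_laplace N \<eta> / G \<eta>) *\<^sub>R E \<eta>) = (LINT \<eta>|lborel. tail_ratio N \<eta> *\<^sub>R E \<eta>)"
  proof -
    have eq: "(truncated_laplace N \<eta> / G \<eta>) *\<^sub>R E \<eta> = E \<eta> - tail_ratio N \<eta> *\<^sub>R E \<eta>" for \<eta>
      by (simp add: tail_ratio_def scaleR_diff_left)
    show "integrable lborel (\<lambda>\<eta>. (truncated_laplace N \<eta> / G \<eta>) *\<^sub>R E \<eta>)"
      unfolding eq using E(1) tail_int[OF E(1)] by simp
    show "(LINT \<eta>|lborel. E \<eta>) - (LINT \<eta>|lborel. (truncated_laplace N \<eta> / G \<eta>) *\<^sub>R E \<eta>) = (LINT \<eta>|lborel. tail_ratio N \<eta> *\<^sub>R E \<eta>)"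
      unfolding eq using E(1) tail_int[OF E(1)] by simp
  qed
  define P where "P = (LINT \<eta>|lborel. (truncated_laplace N \<eta> / G \<eta>) *\<^sub>R E \<eta>)"
  have i: "cmod (S - P) \<le> (LINT \<eta>|lborel. exp (\<bar>Re z\<bar> * \<bar>\<eta>\<bar>) / G \<eta> * (truncated_laplace N \<eta> * exp (N * \<bar>\<eta>\<bar>))) * edge N T"
  proof -
    have int: "integrable lborel (\<lambda>\<eta>. exp (\<bar>Re z\<bar> * \<bar>\<eta>\<bar>) / G \<eta> * (truncated_laplace N \<eta> * exp (N * \<bar>\<eta>\<bar>)))"
    proof (rule Bochner_Integration.integrable_bound)
      \<comment> \<open>The exponent \<open>3 * N\<close> collects \<open>2 * N\<close> from
        \<open>truncated_laplace_growth\<close> and \<open>N\<close> from the shift of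
        lines.\<close>
      show "integrable lborel (\<lambda>\<eta>. G 0 * (exp ((\<bar>Re z\<bar> + 3 * N) * \<bar>\<eta>\<bar>) / G \<eta>))"
        by (intro integrable_mult_right integrable_exp_abs_div_G)
      show "AE \<eta> in lborel. norm (exp (\<bar>Re z\<bar> * \<bar>\<eta>\<bar>) / G \<eta> * (truncated_laplace N \<eta> * exp (N * \<bar>\<eta>\<bar>))) \<le> norm (G 0 * (exp ((\<bar>Re z\<bar> + 3 * N) * \<bar>\<eta>\<bar>) / G \<eta>))"
      proof (rule AE_I2)
        fix \<eta>
        have "exp (\<bar>Re z\<bar> * \<bar>\<eta>\<bar>) / G \<eta> * (truncated_laplace N \<eta> * exp (N * \<bar>\<eta>\<bar>))
           \<le> exp (\<bar>Re z\<bar> * \<bar>\<eta>\<bar>) / G \<eta> * ((exp (2 * N * \<bar>\<eta>\<bar>) * G 0) * exp (N * \<bar>\<eta>\<bar>))"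
          using G_pos[of \<eta>] by (intro mult_left_mono mult_right_mono truncated_laplace_growth) auto
        also have "\<dots> = G 0 * (exp ((\<bar>Re z\<bar> + 3 * N) * \<bar>\<eta>\<bar>) / G \<eta>)"
        proof -
          have "exp (\<bar>Re z\<bar> * \<bar>\<eta>\<bar>) * (exp (2 * N * \<bar>\<eta>\<bar>) * exp (N * \<bar>\<eta>\<bar>)) = exp ((\<bar>Re z\<bar> + 3 * N) * \<bar>\<eta>\<bar>)"
            by (simp add: exp_add[symmetric] algebra_simps)
          then show ?thesis by (simp add: mult_ac)
        qed
        finally show "norm (exp (\<bar>Re z\<bar> * \<bar>\<eta>\<bar>) / G \<eta> * (truncated_laplace N \<eta> * exp (N * \<bar>\<eta>\<bar>))) \<le> norm (G 0 * (exp ((\<bar>Re z\<bar> + 3 * N) * \<bar>\<eta>\<bar>) / G \<eta>))"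
          using G_pos[of \<eta>] G_pos[of 0] truncated_laplace_nonneg[of N \<eta>] by simp
      qed
    qed measurable
    have "cmod (S - P) = cmod (LINT \<eta>|lborel. exp (complex_of_real \<eta> * z) / complex_of_real (G \<eta>) * box_transform N T \<eta> - (truncated_laplace N \<eta> / G \<eta>) *\<^sub>R E \<eta>)"
      unfolding S_def P_def Bochner_Integration.integral_diff[OF box_kernel_integral(1) P] ..
    also have "\<dots> \<le> (LINT \<eta>|lborel. exp (\<bar>Re z\<bar> * \<bar>\<eta>\<bar>) / G \<eta> * (truncated_laplace N \<eta> * exp (N * \<bar>\<eta>\<bar>)) * edge N T)"
    proof (rule norm_integral_le_integral)
      fix \<eta>
      have c: "c \<eta> \<in> {-N..N}" using ab by (auto simp: c_def)
      have eq: "exp (complex_of_real \<eta> * z) / complex_of_real (G \<eta>) * box_transform N T \<eta> - (truncated_laplace N \<eta> / G \<eta>) *\<^sub>R E \<eta>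
        = exp (complex_of_real \<eta> * z) / complex_of_real (G \<eta>) * (box_transform N T \<eta> - truncated_laplace N \<eta> *\<^sub>R vertical_transform T (c \<eta>) \<eta>)"
        by (simp add: E_def scaleR_conv_of_real right_diff_distrib mult_ac)
      have "cmod (exp (complex_of_real \<eta> * z) / complex_of_real (G \<eta>) * box_transform N T \<eta> - (truncated_laplace N \<eta> / G \<eta>) *\<^sub>R E \<eta>)
        = exp (\<eta> * Re z) / G \<eta> * cmod (box_transform N T \<eta> - truncated_laplace N \<eta> *\<^sub>R vertical_transform T (c \<eta>) \<eta>)"
        unfolding eq using G_pos[of \<eta>] by (simp add: norm_mult norm_divide)
      also have "\<dots> \<le> exp (\<bar>Re z\<bar> * \<bar>\<eta>\<bar>) / G \<eta> * (truncated_laplace N \<eta> * (exp (N * \<bar>\<eta>\<bar>) * edge N T))"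
        using G_pos[of \<eta>] T exp_le_exp_abs[of "Re z" \<eta>]
        by (intro mult_mono divide_right_mono box_transform_approx c) (auto simp: mult.commute)
      finally show "cmod (exp (complex_of_real \<eta> * z) / complex_of_real (G \<eta>) * box_transform N T \<eta> - (truncated_laplace N \<eta> / G \<eta>) *\<^sub>R E \<eta>)
         \<le> exp (\<bar>Re z\<bar> * \<bar>\<eta>\<bar>) / G \<eta> * (truncated_laplace N \<eta> * exp (N * \<bar>\<eta>\<bar>)) * edge N T"
        by (simp only: mult.assoc)
    qed (rule integrable_mult_left[OF int])
    also have "\<dots> = (LINT \<eta>|lborel. exp (\<bar>Re z\<bar> * \<bar>\<eta>\<bar>) / G \<eta> * (truncated_laplace N \<eta> * exp (N * \<bar>\<eta>\<bar>))) * edge N T"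
      by (rule integral_mult_left_zero)
    finally show ?thesis .
  qed
  have ii: "cmod (P - integral\<^sup>L lborel E) \<le> sqrt (tail_L2 d N * (2 * pi * B)) + sqrt (tail_L2 d N * (2 * pi * A))"
  proof -
    have "cmod (P - integral\<^sup>L lborel E) = cmod (LINT \<eta>|lborel. tail_ratio N \<eta> *\<^sub>R E \<eta>)"
      unfolding P_eq[symmetric] P_def by (rule norm_minus_commute)
    also have "(LINT \<eta>|lborel. tail_ratio N \<eta> *\<^sub>R E \<eta>) = (LINT \<eta>|lborel. tail_ratio N \<eta> *\<^sub>R Eb \<eta>) + (LINT \<eta>|lborel. tail_ratio N \<eta> *\<^sub>R Ea \<eta>)"
      unfolding E_eq scaleR_add_right by (rule Bochner_Integration.integral_add[OF tail_int tail_int]) (rule Eb Ea)+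
    also have "cmod \<dots> \<le> sqrt (tail_L2 d N * (2 * pi * B)) + sqrt (tail_L2 d N * (2 * pi * A))"
    proof (rule norm_triangle_mono)
      show "cmod (LINT \<eta>|lborel. tail_ratio N \<eta> *\<^sub>R Eb \<eta>) \<le> sqrt (tail_L2 d N * (2 * pi * B))"
        unfolding Eb_def
      proof (rule tail_bound[OF _ _ B d(1)])
        fix \<eta> :: real assume "\<eta> \<in> {0<..}"
        then show "\<eta> * (Re z - b) \<le> - (d * \<bar>\<eta>\<bar>)"
          using mult_left_mono[OF d(2), of \<eta>] by (simp add: algebra_simps)
      qed simp
      show "cmod (LINT \<eta>|lborel. tail_ratio N \<eta> *\<^sub>R Ea \<eta>) \<le> sqrt (tail_L2 d N * (2 * pi * A))"
        unfolding Ea_def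
      proof (rule tail_bound[OF _ _ A d(1)])
        fix \<eta> :: real assume "\<eta> \<in> {..0}"
        then show "\<eta> * (Re z - a) \<le> - (d * \<bar>\<eta>\<bar>)"
          using mult_left_mono[OF d(3), of "- \<eta>"] by (simp add: algebra_simps)
      qed simp
    qed
    finally show ?thesis .
  qed
  have iii: "cmod (integral\<^sup>L lborel E - 2 * pi * f z) \<le> edge N T"
    unfolding E(2) by (rule line_cauchy_difference[OF ab T])
  have "cmod (S - 2 * pi * f z) = cmod ((S - P) + (P - integral\<^sup>L lborel E) + (integral\<^sup>L lborel E - 2 * pi * f z))" by simp
  also have "\<dots> \<le> (LINT \<eta>|lborel. exp (\<bar>Re z\<bar> * \<bar>\<eta>\<bar>) / G \<eta> * (truncated_laplace N \<eta> * exp (N * \<bar>\<eta>\<bar>))) * edge N T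
      + (sqrt (tail_L2 d N * (2 * pi * B)) + sqrt (tail_L2 d N * (2 * pi * A))) + edge N T"
    by (intro norm_triangle_mono i ii iii)
  finally show ?thesis unfolding S_def .
qed

end

section \<open>The Bergman kernel\<close>

text \<open>The product is dominated by the sum of the two weighted squares; this serves both the
  reproducing integral and the uniqueness proof.\<close>

lemma weighted_L2_product_integrable:
  fixes k f :: "complex \<Rightarrow> complex" and r :: "complex \<Rightarrow> real"
  assumes k: "integrable lborel (\<lambda>w. (cmod (k w))\<^sup>2 * r w)" and f: "integrable lborel (\<lambda>w. (cmod (f w))\<^sup>2 * r w)"
    and [measurable]: "k \<in> borel_measurable borel" "f \<in> borel_measurable borel" "r \<in> borel_measurable borel"
    and r: "\<And>w. 0 \<le> r w"
  shows "integrable lborel (\<lambda>w. k w * f w * complex_of_real (r w))"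
proof (rule Bochner_Integration.integrable_bound[OF Bochner_Integration.integrable_add[OF k f]])
  show "AE w in lborel. norm (k w * f w * complex_of_real (r w)) \<le> norm ((cmod (k w))\<^sup>2 * r w + (cmod (f w))\<^sup>2 * r w)"
  proof (rule AE_I2)
    fix w
    have "cmod (k w) * cmod (f w) \<le> (cmod (k w))\<^sup>2 + (cmod (f w))\<^sup>2"
      using sum_squares_bound[of "cmod (k w)" "cmod (f w)", unfolded mult.assoc] mult_nonneg_nonneg[OF norm_ge_zero norm_ge_zero, of "k w" "f w"] by linarith
    from mult_right_mono[OF this r[of w]]
    show "norm (k w * f w * complex_of_real (r w)) \<le> norm ((cmod (k w))\<^sup>2 * r w + (cmod (f w))\<^sup>2 * r w)"
      using r[of w] by (simp add: norm_mult distrib_right)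
  qed
qed measurable

context laplace_bergman_function
begin

lemma kernel_product_integrable:
  "integrable lborel (\<lambda>w. laplace_kernel \<phi> (z + cnj w) * f w * complex_of_real (exp (- 2 * \<phi> (Re w))))"
  by (rule weighted_L2_product_integrable[OF laplace_kernel_L2 weighted_L2]; measurable)

text \<open>Two limits, in this order. For fixed \<open>N\<close>, \<open>T\<close> tends to
  infinity along heights with small edges, which removes the edge terms although their constant
  depends on \<open>N\<close>; then \<open>N\<close> tends to infinity and the tail terms
  \<open>D N\<close> vanish.\<close>

theorem laplace_kernel_reproducing:
  "f z = (LINT w|lborel. laplace_kernel \<phi> (z + cnj w) * f w * complex_of_real (exp (- 2 * \<phi> (Re w))))"
proof -
  define F where "F w = laplace_kernel \<phi> (z + cnj w) * f w * complex_of_real (exp (- 2 * \<phi> (Re w)))" for w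
  have F: "integrable lborel F" unfolding F_def by (rule kernel_product_integrable)
  have [measurable]: "F \<in> borel_measurable borel" using F by auto
  \<comment> \<open>Both lines are fixed before \<open>N\<close>, within distance 1 of
    \<open>z\<close>, so they lie in every strip with \<open>|Re z| + 1 <= N\<close>.\<close>
  obtain a A where a: "Re z - 1 < a" "a < Re z" and A: "0 \<le> A"
    "(\<integral>\<^sup>+v. ennreal ((cmod (f (Complex a v)))\<^sup>2) \<partial>lborel) \<le> ennreal A"
    using line_L2[of "Re z - 1" "Re z"] by auto
  obtain b B where b: "Re z < b" "b < Re z + 1" and B: "0 \<le> B"
    "(\<integral>\<^sup>+v. ennreal ((cmod (f (Complex b v)))\<^sup>2) \<partial>lborel) \<le> ennreal B"
    using line_L2[of "Re z" "Re z + 1"] by auto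
  define d where "d = min (b - Re z) (Re z - a)"
  have d: "0 < d" "d \<le> b - Re z" "d \<le> Re z - a" using a b by (auto simp: d_def)
  define I where "I N = (LINT w|lborel. indicator {-N..N} (Re w) *\<^sub>R F w)" for N
  define D where "D N = sqrt (tail_L2 d N * (2 * pi * B)) + sqrt (tail_L2 d N * (2 * pi * A))" for N
  have main: "cmod (2 * pi * I N - 2 * pi * f z) \<le> D N" if N: "\<bar>Re z\<bar> + 1 \<le> N" for N
  proof -
    define c where "c = (LINT \<eta>|lborel. exp (\<bar>Re z\<bar> * \<bar>\<eta>\<bar>) / G \<eta> * (truncated_laplace N \<eta> * exp (N * \<bar>\<eta>\<bar>)))"
    define J where "J T = (LINT w|lborel. indicator (cbox (Complex (-N) (-T)) (Complex N T)) w *\<^sub>R F w)" for T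
    have ab: "{a..b} \<subseteq> {-N..N}" using a b N by auto
    have est: "cmod (2 * pi * J T - 2 * pi * f z) \<le> c * edge N T + D N + edge N T" if T: "\<bar>Im z\<bar> + 1 < T" for T
    proof -
      have "2 * pi * J T = (LINT \<eta>|lborel. exp (complex_of_real \<eta> * z) / complex_of_real (G \<eta>) * box_transform N T \<eta>)"
        unfolding J_def F_def box_kernel_integral(2) by simp
      then show ?thesis
        unfolding c_def D_def
        using box_kernel_estimate[OF a(2) b(1) ab T A(2,1) B(2,1) d] by simp
    qed
    \<comment> \<open>Heights exceeding \<open>n\<close> make the boxes exhaust the strip, while the
      edge integrals tend to 0.\<close>
    have "\<exists>T. \<forall>n. \<bar>Im z\<bar> + 1 + real n < T n \<and> edge N (T n) < inverse (real (Suc n))"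
    proof (rule choice, rule allI)
      fix n
      obtain T where "\<bar>Im z\<bar> + 1 + real n < T" "edge N T < inverse (real (Suc n))"
        by (rule small_edge[of N "inverse (real (Suc n))" "\<bar>Im z\<bar> + 1 + real n"]) (use N in auto)
      then show "\<exists>T. \<bar>Im z\<bar> + 1 + real n < T \<and> edge N T < inverse (real (Suc n))" by blast
    qed
    then obtain T where T: "\<And>n. \<bar>Im z\<bar> + 1 + real n < T n" "\<And>n. edge N (T n) < inverse (real (Suc n))"
      by blast
    have edge0: "(\<lambda>n. edge N (T n)) \<longlonglongrightarrow> 0"
      by (rule tendsto_sandwich[OF _ _ tendsto_const LIMSEQ_inverse_real_of_nat])
         (use T(2) edge_nonneg in \<open>auto intro!: always_eventually less_imp_le\<close>)
    have J: "(\<lambda>n. J (T n)) \<longlonglongrightarrow> I N"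
      unfolding J_def I_def
    proof (rule integral_dominated_convergence)
      show "integrable lborel (\<lambda>w. norm (F w))" using F by simp
      show "AE w in lborel. (\<lambda>n. indicator (cbox (Complex (-N) (- T n)) (Complex N (T n))) w *\<^sub>R F w) \<longlonglongrightarrow> indicator {-N..N} (Re w) *\<^sub>R F w"
      proof (rule AE_I2, rule tendsto_eventually)
        fix w
        obtain m where m: "\<bar>Im w\<bar> \<le> real m" using real_arch_simple by blast
        show "\<forall>\<^sub>F n in sequentially. indicator (cbox (Complex (-N) (- T n)) (Complex N (T n))) w *\<^sub>R F w = indicator {-N..N} (Re w) *\<^sub>R F w"
        proof (rule eventually_sequentiallyI[of m])
          fix n assume "m \<le> n"
          then have "\<bar>Im w\<bar> \<le> T n" using m T(1)[of n] by linarith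
          then show "indicator (cbox (Complex (-N) (- T n)) (Complex N (T n))) w *\<^sub>R F w = indicator {-N..N} (Re w) *\<^sub>R F w"
            by (auto simp: indicator_def in_cbox_complex_iff)
        qed
      qed
    qed (auto simp: indicator_def)
    show ?thesis
    proof (rule LIMSEQ_le)
      show "(\<lambda>n. cmod (2 * pi * J (T n) - 2 * pi * f z)) \<longlonglongrightarrow> cmod (2 * pi * I N - 2 * pi * f z)"
        by (intro tendsto_intros J)
      have "(\<lambda>n. c * edge N (T n) + D N + edge N (T n)) \<longlonglongrightarrow> c * 0 + D N + 0"
        by (intro tendsto_intros edge0)
      then show "(\<lambda>n. c * edge N (T n) + D N + edge N (T n)) \<longlonglongrightarrow> D N" by simp
      have "\<bar>Im z\<bar> + 1 < T n" for n using T(1)[of n] by linarith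
      then show "\<exists>n0. \<forall>n\<ge>n0. cmod (2 * pi * J (T n) - 2 * pi * f z) \<le> c * edge N (T n) + D N + edge N (T n)"
        using est by blast
    qed
  qed
  have "(\<lambda>n. D (real n)) \<longlonglongrightarrow> sqrt (0 * (2 * pi * B)) + sqrt (0 * (2 * pi * A))"
    unfolding D_def by (intro tendsto_intros tail_L2_tendsto d)
  then have D: "(\<lambda>n. D (real n)) \<longlonglongrightarrow> 0" by simp
  have I: "(\<lambda>n. I (real n)) \<longlonglongrightarrow> integral\<^sup>L lborel F"
    unfolding I_def
  proof (rule integral_dominated_convergence)
    show "integrable lborel (\<lambda>w. norm (F w))" using F by simp
    show "AE w in lborel. (\<lambda>n. indicator {- real n..real n} (Re w) *\<^sub>R F w) \<longlonglongrightarrow> F w"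
    proof (rule AE_I2, rule tendsto_eventually)
      fix w
      obtain m where "\<bar>Re w\<bar> \<le> real m" using real_arch_simple by blast
      then show "\<forall>\<^sub>F n in sequentially. indicator {- real n..real n} (Re w) *\<^sub>R F w = F w"
        by (intro eventually_sequentiallyI[of m]) (auto simp: indicator_def)
    qed
  qed (auto simp: indicator_def)
  have "cmod (2 * pi * integral\<^sup>L lborel F - 2 * pi * f z) \<le> 0"
  proof (rule LIMSEQ_le[OF _ D])
    show "(\<lambda>n. cmod (2 * pi * I (real n) - 2 * pi * f z)) \<longlonglongrightarrow> cmod (2 * pi * integral\<^sup>L lborel F - 2 * pi * f z)"
      by (intro tendsto_intros I)
    obtain m where m: "\<bar>Re z\<bar> + 1 \<le> real m" using real_arch_simple by blast
    show "\<exists>m. \<forall>n\<ge>m. cmod (2 * pi * I (real n) - 2 * pi * f z) \<le> D (real n)"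
      using m by (intro exI[of _ m] allI impI main) linarith
  qed
  then have "f z = integral\<^sup>L lborel F" by simp
  then show ?thesis unfolding F_def .
qed

end

section \<open>Uniqueness of the reproducing kernel\<close>

lemma bergman_space_measurable:
  "f \<in> weighted_bergman_space p \<tau> \<Longrightarrow> f \<in> borel_measurable borel"
  by (intro borel_measurable_continuous_onI holomorphic_on_imp_continuous_on)
     (simp add: weighted_bergman_space_def)

lemma bergman_space_diff:
  assumes p: "p \<in> borel_measurable borel"
    and f: "f \<in> weighted_bergman_space p \<tau>" and g: "g \<in> weighted_bergman_space p \<tau>"
  shows "(\<lambda>w. f w - g w) \<in> weighted_bergman_space p \<tau>"
proof -
  note [measurable] = p f[THEN bergman_space_measurable] g[THEN bergman_space_measurable]
  have "integrable lborel (\<lambda>w. 2 * ((cmod (f w))\<^sup>2 * exp (- 2 * \<tau> * p w) + (cmod (g w))\<^sup>2 * exp (- 2 * \<tau> * p w)))"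
    using f g by (intro integrable_mult_right Bochner_Integration.integrable_add) (auto simp: weighted_bergman_space_def)
  then have "integrable lborel (\<lambda>w. (cmod (f w - g w))\<^sup>2 * exp (- 2 * \<tau> * p w))"
  proof (rule Bochner_Integration.integrable_bound)
    show "AE w in lborel. norm ((cmod (f w - g w))\<^sup>2 * exp (- 2 * \<tau> * p w))
      \<le> norm (2 * ((cmod (f w))\<^sup>2 * exp (- 2 * \<tau> * p w) + (cmod (g w))\<^sup>2 * exp (- 2 * \<tau> * p w)))"
    proof (rule AE_I2)
      fix w
      have "(cmod (f w - g w))\<^sup>2 \<le> (cmod (f w) + cmod (g w))\<^sup>2"
        by (intro power_mono norm_triangle_ineq4) auto
      also have "\<dots> \<le> 2 * ((cmod (f w))\<^sup>2 + (cmod (g w))\<^sup>2)"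
        using sum_squares_bound[of "cmod (f w)" "cmod (g w)"] by (simp add: power2_sum)
      finally have "(cmod (f w - g w))\<^sup>2 * exp (- 2 * \<tau> * p w) \<le> 2 * ((cmod (f w))\<^sup>2 + (cmod (g w))\<^sup>2) * exp (- 2 * \<tau> * p w)"
        by (intro mult_right_mono) auto
      then show "norm ((cmod (f w - g w))\<^sup>2 * exp (- 2 * \<tau> * p w))
        \<le> norm (2 * ((cmod (f w))\<^sup>2 * exp (- 2 * \<tau> * p w) + (cmod (g w))\<^sup>2 * exp (- 2 * \<tau> * p w)))"
        by (simp add: algebra_simps)
    qed
  qed measurable
  then show ?thesis
    using f g by (auto simp: weighted_bergman_space_def intro!: holomorphic_intros)
qed

text \<open>Both kernels are tested on the difference of their own conjugated sections at
  \<open>z\<close>, which belongs to the space. Subtracting shows that its weighted norm is 0, so it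
  vanishes almost everywhere and, by continuity, everywhere.\<close>

lemma bergman_kernel_unique:
  assumes p[measurable]: "p \<in> borel_measurable borel"
    and K: "is_bergman_kernel p \<tau> K" and L: "is_bergman_kernel p \<tau> L"
  shows "K = L"
proof (intro ext)
  fix z w
  define d where "d w = cnj (K z w) - cnj (L z w)" for w
  have Kz: "(\<lambda>w. cnj (K z w)) \<in> weighted_bergman_space p \<tau>" and Lz: "(\<lambda>w. cnj (L z w)) \<in> weighted_bergman_space p \<tau>"
    using K L unfolding is_bergman_kernel_def by blast+
  have d: "d \<in> weighted_bergman_space p \<tau>"
    unfolding d_def by (rule bergman_space_diff[OF p Kz Lz])
  have prod: "integrable lborel (\<lambda>w. k w * d w * complex_of_real (exp (- 2 * \<tau> * p w)))"
    if k: "(\<lambda>w. cnj (k w)) \<in> weighted_bergman_space p \<tau>" for k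
  proof (rule weighted_L2_product_integrable)
    have "(\<lambda>w. cnj (cnj (k w))) \<in> borel_measurable borel"
      by (rule borel_measurable_cnj[OF bergman_space_measurable[OF k]])
    then show "k \<in> borel_measurable borel" by simp
  qed (use k d bergman_space_measurable[OF d] in \<open>auto simp: weighted_bergman_space_def\<close>)
  have "d z = (LINT w|lborel. K z w * d w * complex_of_real (exp (- 2 * \<tau> * p w)))"
    using K d unfolding is_bergman_kernel_def by blast
  moreover have "d z = (LINT w|lborel. L z w * d w * complex_of_real (exp (- 2 * \<tau> * p w)))"
    using L d unfolding is_bergman_kernel_def by blast
  ultimately have "0 = (LINT w|lborel. K z w * d w * complex_of_real (exp (- 2 * \<tau> * p w))) - (LINT w|lborel. L z w * d w * complex_of_real (exp (- 2 * \<tau> * p w)))"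
    by simp
  also have "\<dots> = (LINT w|lborel. K z w * d w * complex_of_real (exp (- 2 * \<tau> * p w)) - L z w * d w * complex_of_real (exp (- 2 * \<tau> * p w)))"
    by (rule Bochner_Integration.integral_diff[OF prod[OF Kz] prod[OF Lz], symmetric])
  also have "\<dots> = (LINT w|lborel. complex_of_real ((cmod (d w))\<^sup>2 * exp (- 2 * \<tau> * p w)))"
  proof (intro Bochner_Integration.integral_cong refl)
    fix w
    have "complex_of_real ((cmod (d w))\<^sup>2) = d w * cnj (d w)" by (rule complex_norm_square)
    moreover have "cnj (d w) = K z w - L z w" by (simp add: d_def)
    ultimately show "K z w * d w * complex_of_real (exp (- 2 * \<tau> * p w)) - L z w * d w * complex_of_real (exp (- 2 * \<tau> * p w))
      = complex_of_real ((cmod (d w))\<^sup>2 * exp (- 2 * \<tau> * p w))"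
      by (simp only: of_real_mult) (simp add: algebra_simps)
  qed
  also have "\<dots> = complex_of_real (LINT w|lborel. (cmod (d w))\<^sup>2 * exp (- 2 * \<tau> * p w))"
    by (rule integral_complex_of_real)
  finally have "(LINT w|lborel. (cmod (d w))\<^sup>2 * exp (- 2 * \<tau> * p w)) = 0" by simp
  then have "AE w in lborel. (cmod (d w))\<^sup>2 * exp (- 2 * \<tau> * p w) = 0"
    using d by (subst (asm) integral_nonneg_eq_0_iff_AE) (auto simp: weighted_bergman_space_def)
  then have ae: "AE w in lborel. d w = 0" by simp
  have cont: "continuous_on UNIV d"
    using d by (intro holomorphic_on_imp_continuous_on) (simp add: weighted_bergman_space_def)
  have "w \<in> {w. d w = 0}"
  proof (rule mem_closed_if_AE_lebesgue)
    show "closed {w. d w = 0}"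
      using cont by (intro closed_Collect_eq continuous_on_const)
    show "AE w in lebesgue. w \<in> {w. d w = 0}"
      using ae by (intro AE_completion) simp
  qed
  then have "d w = 0" by simp
  then show "K z w = L z w" unfolding d_def by (metis complex_cnj_cancel_iff right_minus_eq)
qed

section \<open>Scaling of the weight and the two kernel formulas\<close>

lemma C1_function_continuous: "C1_function f \<Longrightarrow> continuous_on S f"
  unfolding C1_function_def
  by (meson continuous_at_imp_continuous_on has_derivative_continuous)

text \<open>For \<open>\<tau> >= 1\<close> nonnegativity of \<open>q\<close> keeps the exponent
  below the one in the hypothesis; for \<open>\<tau> < 1\<close> the hypothesis at two shifted
  tilts, one for each sign of \<open>r\<close>, is combined with an integrable exponential.\<close>

lemma laplace_weight_scaled:
  fixes q :: "real \<Rightarrow> real"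
  assumes cont: "continuous_on UNIV q" and nonneg: "\<And>x. 0 \<le> q x" and \<tau>: "0 < \<tau>"
    and int: "\<And>y. integrable lborel (\<lambda>x. exp (- 2 * q x + 2 * y * x))"
  shows "laplace_weight (\<lambda>r. \<tau> * q r)"
proof
  show "continuous_on UNIV (\<lambda>r. \<tau> * q r)" by (intro continuous_intros cont)
  have [measurable]: "q \<in> borel_measurable borel"
    using cont by (rule borel_measurable_continuous_onI)
  fix \<eta> :: real
  show "integrable lborel (\<lambda>r. exp (2 * (r * \<eta> - \<tau> * q r)))"
  proof (cases "1 \<le> \<tau>")
    case True
    show ?thesis
    proof (rule Bochner_Integration.integrable_bound[OF int[of \<eta>]])
      have "q r \<le> \<tau> * q r" for r
        using mult_right_mono[OF True nonneg[of r]] by simp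
      then show "AE r in lborel. norm (exp (2 * (r * \<eta> - \<tau> * q r))) \<le> norm (exp (- 2 * q r + 2 * \<eta> * r))"
        by (intro AE_I2) (simp add: algebra_simps)
    qed measurable
  next
    case False
    \<comment> \<open>The exponent is a convex combination, with weights \<open>\<tau>\<close> and \<open>1 - \<tau>\<close>, of an exponent from the hypothesis and \<open>- 2 \<bar>r\<bar>\<close>.\<close>
    define yp where "yp = (\<eta> + (1 - \<tau>)) / \<tau>"
    define ym where "ym = (\<eta> - (1 - \<tau>)) / \<tau>"
    show ?thesis
    proof (rule Bochner_Integration.integrable_bound)
      show "integrable lborel (\<lambda>r. exp (- 2 * q r + 2 * yp * r) + exp (- 2 * q r + 2 * ym * r) + exp (- (2 * \<bar>r\<bar>)))"
        by (intro Bochner_Integration.integrable_add int integrable_exp_neg_abs) simp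
      show "AE r in lborel. norm (exp (2 * (r * \<eta> - \<tau> * q r)))
        \<le> norm (exp (- 2 * q r + 2 * yp * r) + exp (- 2 * q r + 2 * ym * r) + exp (- (2 * \<bar>r\<bar>)))"
      proof (rule AE_I2)
        fix r :: real
        define y where "y = (if 0 \<le> r then yp else ym)"
        \<comment> \<open>Solving this identity for \<open>y\<close>, separately for each sign of
          \<open>r\<close>, gives \<open>yp\<close> and \<open>ym\<close>.\<close>
        have y: "\<tau> * y * r = \<eta> * r + (1 - \<tau>) * \<bar>r\<bar>"
        proof -
          have "\<tau> * y = (if 0 \<le> r then \<eta> + (1 - \<tau>) else \<eta> - (1 - \<tau>))"
            using \<tau> by (simp add: y_def yp_def ym_def)
          then show ?thesis by (simp only:) (auto simp: algebra_simps)
        qed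
        have "2 * (r * \<eta> - \<tau> * q r) = \<tau> * (- 2 * q r + 2 * y * r) + (1 - \<tau>) * (- (2 * \<bar>r\<bar>))"
          using y by (simp add: algebra_simps)
        also have "\<dots> \<le> max (- 2 * q r + 2 * y * r) (- (2 * \<bar>r\<bar>))"
          using \<tau> False
          by - (rule convex_bound_le, auto)
        finally have "exp (2 * (r * \<eta> - \<tau> * q r)) \<le> exp (max (- 2 * q r + 2 * y * r) (- (2 * \<bar>r\<bar>)))"
          by simp
        also have "\<dots> \<le> exp (- 2 * q r + 2 * y * r) + exp (- (2 * \<bar>r\<bar>))"
          by (simp add: max_def)
        also have "\<dots> \<le> exp (- 2 * q r + 2 * yp * r) + exp (- 2 * q r + 2 * ym * r) + exp (- (2 * \<bar>r\<bar>))"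
          by (simp add: y_def)
        finally show "norm (exp (2 * (r * \<eta> - \<tau> * q r)))
          \<le> norm (exp (- 2 * q r + 2 * yp * r) + exp (- 2 * q r + 2 * ym * r) + exp (- (2 * \<bar>r\<bar>)))"
          by simp
      qed
    qed measurable
  qed
qed

lemma laplace_kernel_is_bergman_kernel:
  assumes weight: "laplace_weight \<phi>" and p: "\<And>w. \<tau> * p w = \<phi> (Re w)"
  shows "is_bergman_kernel p \<tau> (\<lambda>z w. laplace_kernel \<phi> (z + cnj w))"
proof -
  interpret laplace_weight \<phi> by (rule weight)
  have e: "exp (- 2 * \<tau> * p w) = exp (- 2 * \<phi> (Re w))" for w
    by (simp add: p mult.assoc)
  show ?thesis
    unfolding is_bergman_kernel_def
  proof (intro conjI allI ballI)
    fix z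
    \<comment> \<open>Conjugating both the argument and the value of a holomorphic function gives a
      holomorphic function of \<open>w\<close> again.\<close>
    have "(cnj \<circ> (\<lambda>s. laplace_kernel \<phi> (z + s)) \<circ> cnj) holomorphic_on UNIV"
      by (intro holomorphic_on_compose_cnj_cnj holomorphic_on_compose_gen[OF _ laplace_kernel_holomorphic, unfolded o_def] holomorphic_intros) auto
    then show "(\<lambda>w. cnj (laplace_kernel \<phi> (z + cnj w))) \<in> weighted_bergman_space p \<tau>"
      using laplace_kernel_L2[of z]
      unfolding weighted_bergman_space_def mem_Collect_eq e complex_mod_cnj by (simp only: o_def)
  next
    fix f z assume "f \<in> weighted_bergman_space p \<tau>"
    then have "f holomorphic_on UNIV" "integrable lborel (\<lambda>w. (cmod (f w))\<^sup>2 * exp (- 2 * \<phi> (Re w)))"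
      unfolding weighted_bergman_space_def mem_Collect_eq e by blast+
    then interpret laplace_bergman_function \<phi> f
      by unfold_locales
    show "f z = (LINT w|lborel. laplace_kernel \<phi> (z + cnj w) * f w * complex_of_real (exp (- 2 * \<tau> * p w)))"
      unfolding e by (rule laplace_kernel_reproducing)
  qed
qed

text \<open>Integrability is part of the conclusion because a divergent Bochner integral would
  silently equal 0, and unique existence because only it gives \<open>THE\<close> in
  \<open>bergman_kernel\<close> its meaning.\<close>

theorem mainTheorem4:
  fixes p :: "complex \<Rightarrow> real"
  assumes "C1_function p"
    and "\<forall>z. 0 \<le> p z"
    and "\<forall>z. p z = p (complex_of_real (Re z))"
    and "\<forall>y::real. integrable lborel
           (\<lambda>x::real. exp (- 2 * p (complex_of_real x) + 2 * y * x))"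
  shows "\<forall>\<tau>>0.
    (\<exists>!K. is_bergman_kernel p \<tau> K) \<and>
    (\<forall>\<eta>::real. integrable lborel
       (\<lambda>r::real. exp (2 * (r * \<eta> - \<tau> * p (complex_of_real r))))) \<and>
    (\<forall>\<eta>::real. integrable lborel
       (\<lambda>r::real. exp (2 * \<tau> * (r * \<eta> - p (complex_of_real r))))) \<and>
    (\<forall>z w.
       integrable lborel (\<lambda>\<eta>::real. exp (complex_of_real \<eta> * (z + cnj w)) /
         complex_of_real (LINT r|lborel. exp (2 * (r * \<eta> - \<tau> * p (complex_of_real r))))) \<and>
       bergman_kernel p \<tau> z w =
         complex_of_real (1 / (2 * pi)) *
         (LINT \<eta>|lborel. exp (complex_of_real \<eta> * (z + cnj w)) /
           complex_of_real (LINT r|lborel. exp (2 * (r * \<eta> - \<tau> * p (complex_of_real r))))) \<and>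
       integrable lborel (\<lambda>\<eta>::real. exp (complex_of_real (\<tau> * \<eta>) * (z + cnj w)) /
         complex_of_real (LINT r|lborel. exp (2 * \<tau> * (r * \<eta> - p (complex_of_real r))))) \<and>
       bergman_kernel p \<tau> z w =
         complex_of_real (\<tau> / (2 * pi)) *
         (LINT \<eta>|lborel. exp (complex_of_real (\<tau> * \<eta>) * (z + cnj w)) /
           complex_of_real (LINT r|lborel. exp (2 * \<tau> * (r * \<eta> - p (complex_of_real r))))))"
proof (intro allI impI)
  fix \<tau> :: real assume \<tau>: "0 < \<tau>"
  define \<phi> where "\<phi> r = \<tau> * p (complex_of_real r)" for r
  have weight: "laplace_weight \<phi>"
    unfolding \<phi>_def
  proof (rule laplace_weight_scaled[OF _ _ \<tau>])
    show "continuous_on UNIV (\<lambda>r. p (complex_of_real r))"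
      by (rule continuous_on_compose2[OF C1_function_continuous[OF assms(1), of UNIV]])
         (auto intro!: continuous_intros)
  qed (use assms in auto)
  then interpret laplace_weight \<phi> .
  have G: "G \<eta> = (LINT r|lborel. exp (2 * (r * \<eta> - \<tau> * p (complex_of_real r))))" for \<eta>
    by (simp add: laplace_integral_def \<phi>_def)
  have exponent: "2 * (r * (\<tau> * \<eta>) - \<tau> * p (complex_of_real r)) = 2 * \<tau> * (r * \<eta> - p (complex_of_real r))" for r \<eta>
    by (simp add: algebra_simps)
  have G_scaled: "G (\<tau> * \<eta>) = (LINT r|lborel. exp (2 * \<tau> * (r * \<eta> - p (complex_of_real r))))" for \<eta>
    unfolding G exponent ..
  have "\<tau> * p w = \<phi> (Re w)" for w
    using assms(3) by (metis \<phi>_def)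
  from laplace_kernel_is_bergman_kernel[OF weight this]
  have K: "is_bergman_kernel p \<tau> (\<lambda>z w. laplace_kernel \<phi> (z + cnj w))" .
  have "p \<in> borel_measurable borel"
    by (intro borel_measurable_continuous_onI C1_function_continuous assms(1))
  note unique = bergman_kernel_unique[OF this _ K]
  have ex1: "\<exists>!K. is_bergman_kernel p \<tau> K"
    using K unique by (rule ex1I)
  have "bergman_kernel p \<tau> = (\<lambda>z w. laplace_kernel \<phi> (z + cnj w))"
    unfolding bergman_kernel_def using K unique by (rule the_equality)
  then have kernel: "bergman_kernel p \<tau> z w = laplace_kernel \<phi> (z + cnj w)" for z w
    by simp
  have int1: "integrable lborel (\<lambda>r. exp (2 * (r * \<eta> - \<tau> * p (complex_of_real r))))" for \<eta>
    using integrable_tilt by (simp add: \<phi>_def)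
  have int2: "integrable lborel (\<lambda>r. exp (2 * \<tau> * (r * \<eta> - p (complex_of_real r))))" for \<eta>
    using int1[of "\<tau> * \<eta>"] unfolding exponent .
  have scaled_int: "integrable lborel (\<lambda>\<eta>. exp (complex_of_real (\<tau> * \<eta>) * s) / complex_of_real (G (\<tau> * \<eta>)))" for s
    using lborel_integrable_real_affine[OF integrable_exp_div_G[of s], of \<tau> 0] \<tau> by simp
  \<comment> \<open>The second form of the kernel is the first after substituting
    \<open>\<tau> * \<eta>\<close> for \<open>\<eta>\<close>, which yields the extra factor
    \<open>\<tau>\<close>.\<close>
  have "(LINT \<eta>|lborel. exp (complex_of_real \<eta> * s) / complex_of_real (G \<eta>)) =
      complex_of_real \<tau> * (LINT \<eta>|lborel. exp (complex_of_real (\<tau> * \<eta>) * s) / complex_of_real (G (\<tau> * \<eta>)))" for s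
    using \<tau> by (subst lborel_integral_real_affine[of \<tau> _ 0]) (simp_all add: scaleR_conv_of_real)
  then have scaled: "laplace_kernel \<phi> s = complex_of_real (\<tau> / (2 * pi)) *
      (LINT \<eta>|lborel. exp (complex_of_real (\<tau> * \<eta>) * s) / complex_of_real (G (\<tau> * \<eta>)))" for s
    unfolding laplace_kernel_def by simp
  show "(\<exists>!K. is_bergman_kernel p \<tau> K) \<and>
    (\<forall>\<eta>::real. integrable lborel
       (\<lambda>r::real. exp (2 * (r * \<eta> - \<tau> * p (complex_of_real r))))) \<and>
    (\<forall>\<eta>::real. integrable lborel
       (\<lambda>r::real. exp (2 * \<tau> * (r * \<eta> - p (complex_of_real r))))) \<and>
    (\<forall>z w.
       integrable lborel (\<lambda>\<eta>::real. exp (complex_of_real \<eta> * (z + cnj w)) /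
         complex_of_real (LINT r|lborel. exp (2 * (r * \<eta> - \<tau> * p (complex_of_real r))))) \<and>
       bergman_kernel p \<tau> z w =
         complex_of_real (1 / (2 * pi)) *
         (LINT \<eta>|lborel. exp (complex_of_real \<eta> * (z + cnj w)) /
           complex_of_real (LINT r|lborel. exp (2 * (r * \<eta> - \<tau> * p (complex_of_real r))))) \<and>
       integrable lborel (\<lambda>\<eta>::real. exp (complex_of_real (\<tau> * \<eta>) * (z + cnj w)) /
         complex_of_real (LINT r|lborel. exp (2 * \<tau> * (r * \<eta> - p (complex_of_real r))))) \<and>
       bergman_kernel p \<tau> z w =
         complex_of_real (\<tau> / (2 * pi)) *
         (LINT \<eta>|lborel. exp (complex_of_real (\<tau> * \<eta>) * (z + cnj w)) /
           complex_of_real (LINT r|lborel. exp (2 * \<tau> * (r * \<eta> - p (complex_of_real r))))))"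
    unfolding G[symmetric] G_scaled[symmetric] kernel
    by (intro conjI allI ex1 int1 int2 integrable_exp_div_G scaled_int scaled laplace_kernel_def)
qed

end
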